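(* Let $k\ge 3$ and $w$ be positive integers with $kw$ odd such that $q=2kw+1$ is a prime power. Then there exist at least $\lceil \frac{w}{4k^4}\rceil$ pairwise orthogonal $k$-cycle systems of order $q$.
   Context: A $k$-cycle $(x_0,\dots,x_{k-1})$ on pairwise distinct vertices is the graph with edges $\{x_0,x_1\},\dots,\{x_{k-2},x_{k-1}\},\{x_{k-1},x_0\}$. A $k$-cycle system of order $n$ is a set of $k$-cycles whose edge sets partition the edge set of the complete graph $K_n$. Two $k$-cycle systems $\mathcal C,\mathcal C'$ of the same order (on the same vertex set) are orthogonal if every cycle of $\mathcal C$ shares at most one edge with every cycle of $\mathcal C'$. *)

theory Defs
  imports Complex_Main "HOL-Number_Theory.Prime_Powers"
begin

definition cycle_edges :: "'a list \<Rightarrow> 'a set set" where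
  "cycle_edges xs = {{xs ! i, xs ! ((i + 1) mod length xs)} | i. i < length xs}"

definition is_k_cycle :: "nat \<Rightarrow> 'a set set \<Rightarrow> bool" where
  "is_k_cycle k C \<longleftrightarrow> (\<exists>xs. length xs = k \<and> distinct xs \<and> C = cycle_edges xs)"

definition complete_edges :: "'a set \<Rightarrow> 'a set set" where
  "complete_edges V = {{x, y} | x y. x \<in> V \<and> y \<in> V \<and> x \<noteq> y}"

definition k_cycle_system :: "nat \<Rightarrow> 'a set \<Rightarrow> 'a set set set \<Rightarrow> bool" where
  "k_cycle_system k V S \<longleftrightarrow>
     (\<forall>C\<in>S. is_k_cycle k C) \<and>
     (\<forall>C\<in>S. \<forall>C'\<in>S. C \<noteq> C' \<longrightarrow> C \<inter> C' = {}) \<and>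
     \<Union>S = complete_edges V"

definition orthogonal_systems :: "'a set set set \<Rightarrow> 'a set set set \<Rightarrow> bool" where
  "orthogonal_systems S S' \<longleftrightarrow> (\<forall>C\<in>S. \<forall>C'\<in>S'. card (C \<inter> C') \<le> 1)"

end

theory Submission
  imports Defs "HOL-Computational_Algebra.Polynomial" "HOL-Number_Theory.Cong"
begin

text \<open>
  Work over the field with q elements. Let W be the subgroup of index k of its multiplicative group
  (so W has order 2w) and let T represent W modulo the sign. If y_0, ..., y_(k-1) have sum zero, if
  y_i lies in the i-th coset of W, and if no shorter block of consecutive terms has sum zero, then the
  partial sums of y form a k-cycle, and its images under the maps v |-> x + t v with t in T form a
  k-cycle system, because the elements t y_i represent all nonzero differences up to sign. The systems
  of y and z are orthogonal unless y_i z_b = y_j z_a or y_i z_b = - y_j z_a for some i, j, a, b with i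
  and j distinct and a and b distinct.

  With M = 2w there are about M^(k-1) / k sequences y, by a second moment estimate for the number of
  solutions of a + b + c = s with a, b, c in three cosets. A fixed z conflicts with at most
  2 k^3 M^(k-2) of them, so a maximal conflict-free set has the required size as soon as
  w > 4 k^4. For smaller w one system is enough, and powers of a k-th root of unity provide it.
\<close>

section \<open>Finite fields\<close>

text \<open>One obstacle is the field itself: q is only known to be a prime power, and the field has
  to be built. Let p be the prime below q and z a complex root of unity of order q - 1. Since p is
  not a unit in Z[z], some prime ideal P of Z[X] contains p and every polynomial vanishing at z.
  Modulo P, X has order exactly q - 1, and the solutions of f^q = f are 0 and the powers of X.

  The constant 4 k^4 is 2 k times 2 k^3: half of the expected M^(k-1) / k zero sums is guaranteed,
  and each chosen one rules out at most 2 k^3 M^(k-2). This gives about M / (4 k^4) = w / (2 k^4)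
  systems, and the spare factor 2 absorbs the sequences with a vanishing block. The range w > 4 k^4
  is where the claimed bound exceeds 1; it also makes the error of the second moment estimate small.

  Oddness of k matters for the single system: its differences have exponents a + 2 w i modulo k w up
  to sign and a constant factor, so 2 must be invertible modulo k.\<close>

definition ideal_set :: "'a::comm_ring_1 set \<Rightarrow> bool" where
  "ideal_set I \<longleftrightarrow> 0 \<in> I \<and> (\<forall>x\<in>I. \<forall>y\<in>I. x + y \<in> I) \<and> (\<forall>a. \<forall>x\<in>I. a * x \<in> I)"

lemma ideal_set_uminus: "ideal_set I \<Longrightarrow> x \<in> I \<Longrightarrow> - x \<in> I"
  unfolding ideal_set_def by (metis mult_minus1)

lemma ideal_set_diff: "ideal_set I \<Longrightarrow> x \<in> I \<Longrightarrow> y \<in> I \<Longrightarrow> x - y \<in> I"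
  using ideal_set_uminus[of I y] unfolding ideal_set_def by (metis uminus_add_conv_diff add.commute)

lemma ideal_set_mult_right: "ideal_set I \<Longrightarrow> x \<in> I \<Longrightarrow> x * a \<in> I"
  unfolding ideal_set_def by (simp add: mult.commute)

lemma ideal_set_sum: "ideal_set I \<Longrightarrow> (\<And>x. x \<in> A \<Longrightarrow> f x \<in> I) \<Longrightarrow> sum f A \<in> I"
  by (induction A rule: infinite_finite_induct) (auto simp: ideal_set_def)

definition prime_ideal_set :: "'a::comm_ring_1 set \<Rightarrow> bool" where
  "prime_ideal_set P \<longleftrightarrow> ideal_set P \<and> 1 \<notin> P \<and> (\<forall>x y. x * y \<in> P \<longrightarrow> x \<in> P \<or> y \<in> P)"

text \<open>Zorn's lemma gives an ideal that is maximal among those containing I and avoiding 1, and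
  maximal ideals are prime.\<close>

lemma ex_prime_ideal_set:
  fixes I :: "'a::comm_ring_1 set"
  assumes I: "ideal_set I" "1 \<notin> I"
  shows "\<exists>P. prime_ideal_set P \<and> I \<subseteq> P"
proof -
  define \<A> where "\<A> = {J. ideal_set J \<and> 1 \<notin> J \<and> I \<subseteq> J}"
  have "\<exists>M\<in>\<A>. \<forall>X\<in>\<A>. M \<subseteq> X \<longrightarrow> X = M"
  proof (rule subset_Zorn_nonempty)
    show "\<A> \<noteq> {}" using I by (auto simp: \<A>_def)
    fix C assume C: "C \<noteq> {}" "subset.chain \<A> C"
    have sub: "\<And>J. J \<in> C \<Longrightarrow> ideal_set J \<and> 1 \<notin> J \<and> I \<subseteq> J"
      using C unfolding subset.chain_def \<A>_def by auto
    have lin: "\<And>J J'. J \<in> C \<Longrightarrow> J' \<in> C \<Longrightarrow> J \<subseteq> J' \<or> J' \<subseteq> J"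
      using C unfolding subset.chain_def by auto
    have "ideal_set (\<Union>C)" unfolding ideal_set_def
    proof (intro conjI ballI allI)
      show "0 \<in> \<Union>C" using C(1) sub unfolding ideal_set_def by blast
      show "x + y \<in> \<Union>C" if "x \<in> \<Union>C" "y \<in> \<Union>C" for x y
      proof -
        obtain J J' where "J \<in> C" "J' \<in> C" "x \<in> J" "y \<in> J'" using \<open>x \<in> \<Union>C\<close> \<open>y \<in> \<Union>C\<close> by blast
        then obtain J'' where "J'' \<in> C" "x \<in> J''" "y \<in> J''" using lin by blast
        then show ?thesis using sub unfolding ideal_set_def by blast
      qed
      show "a * x \<in> \<Union>C" if "x \<in> \<Union>C" for a x
        using that sub unfolding ideal_set_def by blast
    qed
    then show "\<Union>C \<in> \<A>" using sub C(1) unfolding \<A>_def by blast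
  qed
  then obtain P where P: "ideal_set P" "1 \<notin> P" "I \<subseteq> P"
    and max: "\<And>J. ideal_set J \<Longrightarrow> 1 \<notin> J \<Longrightarrow> P \<subseteq> J \<Longrightarrow> J = P"
    unfolding \<A>_def by (smt (verit) mem_Collect_eq order_trans)
  have "x \<in> P \<or> y \<in> P" if xy: "x * y \<in> P" for x y
  proof (rule ccontr)
    assume "\<not> (x \<in> P \<or> y \<in> P)"
    then have n: "x \<notin> P" "y \<notin> P" by auto
    \<comment> \<open>The ideal generated by P and x is strictly larger than P, so it contains 1;
      multiplying that representation of 1 by y puts y into P.\<close>
    define J where "J = {u + a * x | u a. u \<in> P}"
    have "ideal_set J" unfolding ideal_set_def
    proof (intro conjI ballI allI)
      show "0 \<in> J" unfolding J_def using P(1) by (force simp: ideal_set_def intro: exI[of _ 0])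
      show "s + t \<in> J" if st: "s \<in> J" "t \<in> J" for s t
      proof -
        obtain u a v b where "s = u + a * x" "t = v + b * x" "u \<in> P" "v \<in> P"
          using st unfolding J_def by blast
        then have "s + t = (u + v) + (a + b) * x" "u + v \<in> P"
          using P(1) by (auto simp: algebra_simps ideal_set_def)
        then show ?thesis unfolding J_def by blast
      qed
      show "c * s \<in> J" if s: "s \<in> J" for c s
      proof -
        obtain u a where "s = u + a * x" "u \<in> P" using s unfolding J_def by blast
        then have "c * s = c * u + (c * a) * x" "c * u \<in> P"
          using P(1) by (auto simp: algebra_simps ideal_set_def)
        then show ?thesis unfolding J_def by blast
      qed
    qed
    moreover have "P \<subseteq> J" unfolding J_def by (force intro: exI[of _ 0])
    moreover have "x \<in> J" unfolding J_def using P(1) by (force simp: ideal_set_def intro: exI[of _ 1] exI[of _ 0])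
    ultimately have "1 \<in> J" using max n(1) by blast
    then obtain u a where ua: "1 = u + a * x" "u \<in> P" unfolding J_def by blast
    have "y = y * u + a * (x * y)" using ua(1) by (metis (no_types, lifting) distrib_left mult.assoc mult.commute mult.right_neutral)
    then have "y \<in> P" using P(1) ua(2) xy unfolding ideal_set_def by metis
    then show False using n by blast
  qed
  then show ?thesis using P unfolding prime_ideal_set_def by blast
qed

lemma ideal_set_power_diff:
  assumes "ideal_set I" "x - y \<in> I"
  shows "x ^ n - y ^ n \<in> I"
  using assms by (simp add: power_diff_sumr2 ideal_set_mult_right)

text \<open>The inner binomial coefficients of exponent p are multiples of p, and the step from p^m
  to p^(m+1) takes p-th powers. This is what makes the solutions of f^q = f closed under
  addition.\<close>

lemma frobenius_mod_ideal_set: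
  fixes x y :: "'a::comm_ring_1"
  assumes I: "ideal_set I" and p: "prime p" "of_nat p \<in> I"
  shows "(x + y) ^ (p ^ m) - (x ^ (p ^ m) + y ^ (p ^ m)) \<in> I"
proof (induction m)
  case 0
  then show ?case using I by (simp add: ideal_set_def)
next
  case (Suc m)
  have step: "(a + b) ^ p - (a ^ p + b ^ p) \<in> I" for a b :: 'a
  proof -
    have "{..p} = insert 0 (insert p {0<..<p})" using prime_gt_0_nat[OF p(1)] by auto
    then have "(a + b) ^ p - (a ^ p + b ^ p) = (\<Sum>k\<in>{0<..<p}. of_nat (p choose k) * a ^ k * b ^ (p - k))"
      using prime_gt_0_nat[OF p(1)] by (simp add: binomial_ring)
    also have "\<dots> \<in> I"
    proof (rule ideal_set_sum[OF I])
      fix k assume "k \<in> {0<..<p}"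
      then obtain c where "p choose k = p * c" using dvd_choose_prime[OF _ _ _ p(1), of k] by auto
      then have "of_nat (p choose k) * a ^ k * b ^ (p - k) = of_nat p * (of_nat c * a ^ k * b ^ (p - k))"
        by (simp add: mult.assoc)
      then show "of_nat (p choose k) * a ^ k * b ^ (p - k) \<in> I"
        using ideal_set_mult_right[OF I p(2)] by simp
    qed
    finally show ?thesis .
  qed
  define u v where "u = x ^ (p ^ m)" and "v = y ^ (p ^ m)"
  have "((x + y) ^ (p ^ m)) ^ p - (u + v) ^ p \<in> I"
    using ideal_set_power_diff[OF I Suc.IH] unfolding u_def v_def .
  moreover have "(u + v) ^ p - (u ^ p + v ^ p) \<in> I" by (rule step)
  ultimately have "((x + y) ^ (p ^ m)) ^ p - (u ^ p + v ^ p) \<in> I"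
    using I unfolding ideal_set_def by (metis add_diff_eq diff_add_cancel)
  then show ?case unfolding u_def v_def by (simp add: power_mult [symmetric] mult.commute)
qed

text \<open>The singleton of 1 is linearly independent over the rationals, so its value extends. The
  functional takes the place of a theory of algebraic integers in
  \<open>prime_not_unit_cyclotomic\<close>.\<close>

lemma ex_rat_linear_functional:
  "\<exists>l :: complex \<Rightarrow> rat. l 1 = 1 \<and> (\<forall>x y. l (x + y) = l x + l y) \<and> (\<forall>r x. l (of_rat r * x) = r * l x)"
proof -
  interpret V: vector_space "\<lambda>(r::rat) (x::complex). of_rat r * x"
    by standard (auto simp: algebra_simps of_rat_add of_rat_mult)
  interpret W: vector_space "\<lambda>(r::rat) (x::rat). r * x"
    by standard (auto simp: algebra_simps)
  interpret VW: vector_space_pair "\<lambda>(r::rat) (x::complex). of_rat r * x" "\<lambda>(r::rat) (x::rat). r * x"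
    by unfold_locales
  have "V.independent {1}" by simp
  from VW.linear_independent_extend[OF this, of "\<lambda>_. 1"] obtain l
    where l: "Vector_Spaces.linear (\<lambda>(r::rat) (x::complex). of_rat r * x) (\<lambda>(r::rat) (x::rat). r * x) l" "l 1 = 1"
    by auto
  interpret l: Vector_Spaces.linear "\<lambda>(r::rat) (x::complex). of_rat r * x" "\<lambda>(r::rat) (x::rat). r * x" l
    by (rule l)
  show ?thesis using l(2) l.add l.scale by blast
qed

section \<open>Evaluation of integer polynomials at a complex root of unity\<close>

definition int_poly_eval :: "complex \<Rightarrow> int poly \<Rightarrow> complex" where
  "int_poly_eval z f = poly (map_poly of_int f) z"

lemma int_poly_eval_pCons: "int_poly_eval z (pCons a f) = of_int a + z * int_poly_eval z f"
  by (simp add: int_poly_eval_def map_poly_pCons)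

lemma int_poly_eval_0: "int_poly_eval z 0 = 0"
  by (simp add: int_poly_eval_def)

lemma int_poly_eval_add: "int_poly_eval z (f + g) = int_poly_eval z f + int_poly_eval z g"
  by (induction f g rule: poly_induct2) (auto simp: int_poly_eval_pCons int_poly_eval_0 algebra_simps)

lemma int_poly_eval_smult: "int_poly_eval z (smult a f) = of_int a * int_poly_eval z f"
  by (induction f) (auto simp: int_poly_eval_pCons int_poly_eval_0 algebra_simps)

lemma int_poly_eval_mult: "int_poly_eval z (f * g) = int_poly_eval z f * int_poly_eval z g"
  by (induction f) (auto simp: int_poly_eval_pCons int_poly_eval_0 int_poly_eval_add int_poly_eval_smult algebra_simps)

lemma int_poly_eval_1: "int_poly_eval z 1 = 1"
  by (simp add: int_poly_eval_def)

lemma int_poly_eval_power: "int_poly_eval z (f ^ n) = int_poly_eval z f ^ n"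
  by (induction n) (auto simp: int_poly_eval_1 int_poly_eval_mult)

lemma int_poly_eval_diff: "int_poly_eval z (f - g) = int_poly_eval z f - int_poly_eval z g"
  using int_poly_eval_add[of z "f - g" g] by simp

lemma int_poly_eval_sum: "int_poly_eval z (sum f A) = (\<Sum>x\<in>A. int_poly_eval z (f x))"
  by (induction A rule: infinite_finite_induct) (auto simp: int_poly_eval_0 int_poly_eval_add)

lemma int_poly_eval_prod: "int_poly_eval z (prod f A) = (\<Prod>x\<in>A. int_poly_eval z (f x))"
  by (induction A rule: infinite_finite_induct) (auto simp: int_poly_eval_1 int_poly_eval_mult)

lemma int_poly_eval_of_nat: "int_poly_eval z (of_nat n) = of_nat n"
  by (induction n) (auto simp: int_poly_eval_0 int_poly_eval_1 int_poly_eval_add)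

lemma int_poly_eval_X: "int_poly_eval z [:0, 1:] = z"
  by (simp add: int_poly_eval_pCons int_poly_eval_0)

lemmas int_poly_eval_hom = int_poly_eval_0 int_poly_eval_1 int_poly_eval_X int_poly_eval_of_nat int_poly_eval_pCons
  int_poly_eval_add int_poly_eval_diff int_poly_eval_mult int_poly_eval_power int_poly_eval_sum int_poly_eval_prod

text \<open>Z[z] is spanned by finitely many powers of z, so a single common denominator serves all
  its elements.\<close>

lemma poly_int_unity_reduce:
  fixes z :: complex and f :: "int poly"
  assumes "z ^ n = 1" "n > 0"
  shows "\<exists>b :: nat \<Rightarrow> int. int_poly_eval z f = (\<Sum>j<n. of_int (b j) * z ^ j)"
proof (induction f)
  case 0
  show ?case by (rule exI[of _ "\<lambda>_. 0"]) (simp add: int_poly_eval_0)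
next
  case (pCons a f)
  then obtain b where b: "int_poly_eval z f = (\<Sum>j<n. of_int (b j) * z ^ j)" by blast
  obtain m where m: "n = Suc m" using assms(2) by (cases n) auto
  \<comment> \<open>Multiplication by z shifts the coefficients cyclically, because z^n = 1 sends
    the last one to the constant term.\<close>
  define c where "c = (\<lambda>j. case j of 0 \<Rightarrow> a + b m | Suc i \<Rightarrow> b i)"
  have "int_poly_eval z (pCons a f) = of_int a + (\<Sum>j<n. of_int (b j) * z ^ Suc j)"
    using b by (simp add: int_poly_eval_pCons sum_distrib_left algebra_simps)
  also have "(\<Sum>j<n. of_int (b j) * z ^ Suc j) = (\<Sum>j<m. of_int (b j) * z ^ Suc j) + of_int (b m)"
    using assms(1) unfolding m by simp
  also have "of_int a + \<dots> = (\<Sum>j<n. of_int (c j) * z ^ j)"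
    unfolding m sum.lessThan_Suc_shift by (simp add: c_def)
  finally show ?case by blast
qed

text \<open>A rational-linear functional on the complex numbers with value 1 at 1 has, after scaling by a
  common denominator D, integer values on Z[z]. If p were a unit there, every power of p would divide D.\<close>
lemma prime_not_unit_cyclotomic:
  fixes z :: complex and g :: "int poly"
  assumes z: "z ^ n = 1" "n > 0" and p: "p > (1::nat)"
  shows "of_nat p * int_poly_eval z g \<noteq> 1"
proof
  assume g: "of_nat p * int_poly_eval z g = 1"
  obtain l :: "complex \<Rightarrow> rat" where l: "l 1 = 1" "\<And>x y. l (x + y) = l x + l y"
    "\<And>r x. l (of_rat r * x) = r * l x" using ex_rat_linear_functional by blast
  have l0: "l 0 = 0" using l(2)[of 0 0] by simp
  have lsum: "l (sum f A) = (\<Sum>x\<in>A. l (f x))" for f and A :: "nat set"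
    by (induction A rule: infinite_finite_induct) (auto simp: l l0)
  define d where "d j = snd (quotient_of (l (z ^ j)))" for j
  define e where "e j = fst (quotient_of (l (z ^ j)))" for j
  have dpos: "d j > 0" for j unfolding d_def by (rule quotient_of_denom_pos') 
  have de: "of_int (d j) * l (z ^ j) = of_int (e j)" for j
    using quotient_of_div[of "l (z ^ j)" "e j" "d j"] dpos[of j] by (simp add: d_def e_def field_simps)
  define D where "D = (\<Prod>j<n. d j)"
  have Dpos: "D > 0" unfolding D_def using dpos by (simp add: prod_pos)
  have int: "\<exists>c::int. of_int D * l (int_poly_eval z f) = of_int c" for f
  proof -
    obtain b :: "nat \<Rightarrow> int" where b: "int_poly_eval z f = (\<Sum>j<n. of_int (b j) * z ^ j)"
      using poly_int_unity_reduce[OF z] by blast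
    have "\<exists>c::int. of_int D * l (of_int (b j) * z ^ j) = of_int c" if j: "j < n" for j
    proof -
      obtain D' where D': "D = d j * D'" using j unfolding D_def
        by (meson dvdE dvd_prodI finite_lessThan lessThan_iff)
      have "of_int D * l (of_int (b j) * z ^ j) = of_int D * (of_int (b j) * l (z ^ j))"
        using l(3)[of "of_int (b j)" "z ^ j"] by simp
      also have "\<dots> = of_int (D' * b j) * (of_int (d j) * l (z ^ j))" by (simp add: D')
      also have "\<dots> = of_int (D' * b j * e j)" by (simp add: de)
      finally show ?thesis by blast
    qed
    then obtain c where "\<And>j. j < n \<Longrightarrow> of_int D * l (of_int (b j) * z ^ j) = of_int (c j :: int)" by metis
    then have "of_int D * l (int_poly_eval z f) = of_int (\<Sum>j<n. c j)"
      unfolding b lsum by (simp add: sum_distrib_left)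
    then show ?thesis by blast
  qed
  have "int p ^ N dvd D" for N
  proof -
    obtain c where c: "of_int D * l (int_poly_eval z (g ^ N)) = of_int c" using int by blast
    have "(of_nat p ^ N) * int_poly_eval z (g ^ N) = 1"
      using g by (simp add: int_poly_eval_hom flip: power_mult_distrib)
    then have "of_rat (of_nat p ^ N) * int_poly_eval z (g ^ N) = 1"
      by (simp add: of_rat_power)
    then have "of_nat p ^ N * l (int_poly_eval z (g ^ N)) = 1"
      using l(1,3) by metis
    then have "(of_int D :: rat) = of_nat p ^ N * of_int c" using c
      by (metis mult.left_commute mult.right_neutral)
    then have "D = int p ^ N * c" by (metis of_int_eq_iff of_int_mult of_int_of_nat_eq of_int_power)
    then show ?thesis by simp
  qed
  \<comment> \<open>The exponent \<open>nat D\<close> is chosen because p^N > N, so this power of p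
    is too large to divide D.\<close>
  then have "int p ^ nat D \<le> D" using Dpos by (simp add: zdvd_imp_le)
  moreover have "D < int p ^ nat D"
  proof -
    have "nat D < p ^ nat D" using p by (simp add: power_gt_expt)
    then show ?thesis using Dpos by (metis nat_less_iff of_nat_power order_less_imp_le)
  qed
  ultimately show False by simp
qed

text \<open>Both sides are monic of degree n in y and vanish at the n distinct powers of z.\<close>

lemma prod_unity_roots:
  fixes y :: complex
  assumes n: "n > 0" and z: "z = cis (2 * pi / real n)"
  shows "(\<Prod>j<n. y - z ^ j) = y ^ n - 1"
proof -
  define R where "R = (\<lambda>j. z ^ j) ` {..<n}"
  have zn: "z ^ j = cis (2 * pi * real j / real n)" for j
    unfolding z by (simp add: DeMoivre mult.commute)
  have "bij_betw (\<lambda>j. cis (2 * pi * real j / real n)) {..<n} {z. z ^ n = 1}"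
    by (rule bij_betw_roots_unity[OF n])
  then have inj: "inj_on (\<lambda>j. z ^ j) {..<n}" and R: "R = {z. z ^ n = 1}"
    unfolding R_def bij_betw_def zn by auto
  have "card R = n" unfolding R_def by (simp add: card_image inj)
  have "(\<Prod>x\<in>R. [:- x, 1:]) = monom 1 n - 1"
  proof (rule poly_eqI_degree_lead_coeff[where n = n and A = R])
    have deg: "degree (\<Prod>x\<in>R. [:- x, 1:]) = n"
      using \<open>card R = n\<close> by (subst degree_prod_eq_sum_degree) auto
    then show "degree (\<Prod>x\<in>R. [:- x, 1:]) \<le> n" by simp
    show "degree (monom 1 n - 1 :: complex poly) \<le> n"
      by (rule degree_diff_le) (auto simp: degree_monom_eq)
    have "coeff (\<Prod>x\<in>R. [:- x, 1:]) n = lead_coeff (\<Prod>x\<in>R. [:- x, 1:])" by (simp only: deg)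
    also have "\<dots> = 1" by (simp add: lead_coeff_prod)
    finally show "coeff (\<Prod>x\<in>R. [:- x, 1:]) n = coeff (monom 1 n - 1) n" using n by simp
    show "poly (\<Prod>x\<in>R. [:- x, 1:]) w = poly (monom 1 n - 1) w" if "w \<in> R" for w
    proof -
      have "finite R" unfolding R_def by simp
      then have "(\<Prod>x\<in>R. w - x) = 0" using that by (auto intro: prod_zero)
      moreover have "w ^ n = 1" using that R by auto
      ultimately show ?thesis by (simp add: poly_prod poly_monom)
    qed
  qed (use \<open>card R = n\<close> in auto)
  then have "poly (\<Prod>x\<in>R. [:- x, 1:]) y = poly (monom 1 n - 1) y" by simp
  then have "(\<Prod>x\<in>R. y - x) = y ^ n - 1" by (simp add: poly_prod poly_monom)
  then show ?thesis unfolding R_def by (simp add: prod.reindex inj)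
qed

text \<open>A prime ideal containing the prime divisor of q and all polynomials vanishing at a primitive complex
  root of unity of order q - 1; the residue field has q elements and is generated by X.\<close>
definition gf_ideal_spec :: "nat \<Rightarrow> int poly set \<Rightarrow> bool" where
  "gf_ideal_spec q P \<longleftrightarrow> ideal_set P \<and>
     (primepow q \<longrightarrow>
       [:0, 1:] ^ (q - 1) - 1 \<in> P \<and>
       (\<forall>d. 0 < d \<longrightarrow> d < q - 1 \<longrightarrow> [:0, 1:] ^ d - 1 \<notin> P) \<and>
       (\<forall>f. f ^ q - f \<in> P \<longrightarrow> f \<in> P \<or> (\<exists>j<q - 1. f - [:0, 1:] ^ j \<in> P)) \<and>
       (\<forall>f g. (f + g) ^ q - (f ^ q + g ^ q) \<in> P) \<and> 1 \<notin> P)"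

text \<open>Identities among the powers of z in the complex numbers become congruences modulo P,
  since P contains all polynomials vanishing at z.\<close>

lemma ex_gf_ideal_spec: "\<exists>P. gf_ideal_spec q P"
proof (cases "primepow q")
  case False
  \<comment> \<open>The zero ideal is a default that makes \<open>gf_ideal q\<close> an ideal at
    every index q, as the product ring requires.\<close>
  have "gf_ideal_spec q {0}" using False by (simp add: gf_ideal_spec_def ideal_set_def)
  then show ?thesis by blast
next
  case True
  then obtain p m where p: "prime p" and m: "m > 0" and q: "q = p ^ m" unfolding primepow_def by blast
  have p1: "p > 1" using p prime_gt_1_nat by blast
  have q1: "q > 1" using primepow_gt_Suc_0[OF True] by simp
  define n where "n = q - 1"
  have n: "n > 0" "q = Suc n" using q1 by (auto simp: n_def)
  define z where "z = cis (2 * pi / real n)"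
  define X :: "int poly" where "X = [:0, 1:]"
  have zprod: "(\<Prod>j<n. y - z ^ j) = y ^ n - 1" for y by (rule prod_unity_roots[OF n(1) z_def])
  have zn: "z ^ n = 1" using n(1) by (simp add: z_def DeMoivre)
  have zd: "z ^ d \<noteq> 1" if "0 < d" "d < n" for d
  proof
    assume "z ^ d = 1"
    have "inj_on (\<lambda>j. cis (2 * pi * real j / real n)) {..<n}"
      using bij_betw_roots_unity[OF n(1)] unfolding bij_betw_def by blast
    moreover have "cis (2 * pi * real d / real n) = cis (2 * pi * real 0 / real n)"
      using \<open>z ^ d = 1\<close> unfolding z_def by (simp add: DeMoivre mult.commute)
    ultimately show False using that n(1) unfolding inj_on_def by (metis lessThan_iff less_numeral_extra(3))
  qed
  \<comment> \<open>The preimage of p Z[z] under evaluation: it contains both p and the kernel, and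
    it is proper because p is not a unit.\<close>
  define I where "I = {f. \<exists>g. int_poly_eval z f = of_nat p * int_poly_eval z g}"
  have "ideal_set I" unfolding ideal_set_def I_def
  proof (intro conjI ballI allI, goal_cases)
    case 1 show ?case by (auto simp: int_poly_eval_hom intro: exI[of _ 0])
  next
    case (2 x y) then show ?case by (auto simp: int_poly_eval_add simp flip: distrib_left) (metis int_poly_eval_add)
  next
    case (3 a x) then show ?case by (auto simp: int_poly_eval_mult mult.left_commute) (metis int_poly_eval_mult)
  qed
  moreover have "1 \<notin> I"
    unfolding I_def using prime_not_unit_cyclotomic[OF zn n(1) p1] by (auto simp: int_poly_eval_1)
  ultimately obtain P where P: "prime_ideal_set P" "I \<subseteq> P" using ex_prime_ideal_set by blast
  have iP: "ideal_set P" and oneP: "1 \<notin> P" and primeP: "\<And>x y. x * y \<in> P \<Longrightarrow> x \<in> P \<or> y \<in> P"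
    using P(1) unfolding prime_ideal_set_def by auto
  have ker: "f \<in> P" if "int_poly_eval z f = 0" for f
    using that P(2) unfolding I_def by (metis (mono_tags, lifting) int_poly_eval_0 mem_Collect_eq mult_zero_right subsetD)
  have pP: "of_nat p \<in> P"
    using P(2) unfolding I_def by (metis (mono_tags, lifting) int_poly_eval_1 int_poly_eval_of_nat mem_Collect_eq mult.right_neutral subsetD)
  have qP: "of_nat q \<in> P"
  proof -
    have "of_nat q = of_nat p * (of_nat p ^ (m - 1) :: int poly)"
      unfolding q using m by (cases m) simp_all
    then show ?thesis using ideal_set_mult_right[OF iP pP] by simp
  qed
  have 1: "X ^ n - 1 \<in> P" by (rule ker) (simp add: X_def int_poly_eval_hom zn)
  \<comment> \<open>If X^d were 1 modulo P, the sum of the n powers of X^d would be n modulo P. At z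
    this sum vanishes, so n = q - 1 would lie in P together with q, and hence 1 as well.\<close>
  have 2: "X ^ d - 1 \<notin> P" if d: "0 < d" "d < n" for d
  proof
    assume "X ^ d - 1 \<in> P"
    then have "(X ^ d) ^ i - 1 ^ i \<in> P" for i by (rule ideal_set_power_diff[OF iP])
    then have "(\<Sum>i<n. (X ^ d) ^ i - 1 ^ i) \<in> P" by (intro ideal_set_sum[OF iP])
    then have a: "(\<Sum>i<n. (X ^ d) ^ i) - of_nat n \<in> P" by (simp add: sum_subtractf)
    have "(z ^ d) ^ n = 1" using zn by (metis mult.commute power_mult power_one)
    then have "(z ^ d - 1) * (\<Sum>i<n. (z ^ d) ^ i) = 0" by (metis power_diff_1_eq cancel_comm_monoid_add_class.diff_cancel)
    then have "(\<Sum>i<n. (z ^ d) ^ i) = 0" using zd[OF d] by simp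
    then have "(\<Sum>i<n. (X ^ d) ^ i) \<in> P" by (intro ker) (simp add: X_def int_poly_eval_hom)
    then have "of_nat n \<in> P" using ideal_set_diff[OF iP _ a, of "\<Sum>i<n. (X ^ d) ^ i"] by simp
    then have "of_nat q - of_nat n \<in> P" by (rule ideal_set_diff[OF iP qP])
    then show False using oneP by (simp add: n(2))
  qed
  \<comment> \<open>Modulo P, f^q - f is f times the product of all f - X^j, and P is prime.\<close>
  have 3: "f \<in> P \<or> (\<exists>j<n. f - X ^ j \<in> P)" if f: "f ^ q - f \<in> P" for f
  proof -
    have "f * (f ^ n - 1) \<in> P" using f by (simp add: n(2) algebra_simps)
    moreover have "f ^ n - 1 - (\<Prod>j<n. f - X ^ j) \<in> P"
      by (rule ker) (simp add: X_def int_poly_eval_hom zprod)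
    ultimately have "f * (f ^ n - 1) - f * (f ^ n - 1 - (\<Prod>j<n. f - X ^ j)) \<in> P"
      using iP by (intro ideal_set_diff) (auto simp: ideal_set_def)
    then have "f * (\<Prod>j<n. f - X ^ j) \<in> P" by (simp add: algebra_simps)
    then have "f \<in> P \<or> (\<Prod>j<n. f - X ^ j) \<in> P" by (rule primeP)
    moreover have "\<exists>j<N. f - X ^ j \<in> P" if "(\<Prod>j<N. f - X ^ j) \<in> P" for N
      using that
    proof (induction N)
      case 0 then show ?case using oneP by simp
    next
      case (Suc N)
      then show ?case using primeP[of "\<Prod>j<N. f - X ^ j" "f - X ^ N"] less_Suc_eq by auto
    qed
    ultimately show ?thesis by blast
  qed
  have 4: "(f + g) ^ q - (f ^ q + g ^ q) \<in> P" for f g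
    unfolding q by (rule frobenius_mod_ideal_set[OF iP p pP])
  have "gf_ideal_spec q P"
    unfolding gf_ideal_spec_def using iP 1 2 3 4 oneP by (auto simp: X_def n_def)
  then show ?thesis by blast
qed

section \<open>The quotient rings inside one ring, and the field in one of its components\<close>

definition gf_ideal :: "nat \<Rightarrow> int poly set" where
  "gf_ideal q = (SOME P. gf_ideal_spec q P)"

lemma gf_ideal_spec: "gf_ideal_spec q (gf_ideal q)"
  unfolding gf_ideal_def by (rule someI_ex[OF ex_gf_ideal_spec])

lemma ideal_set_gf_ideal: "ideal_set (gf_ideal q)"
  using gf_ideal_spec[of q] by (simp add: gf_ideal_spec_def)

(* Otherwise lift_definition would also unfold the polynomials into coefficient functions. *)
lifting_forget poly.lifting

lemma
  fixes a a' b b' :: "'a::comm_ring_1"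
  assumes I: "ideal_set I" and a: "a - a' \<in> I" and b: "b - b' \<in> I"
  shows ideal_set_cong_add: "a + b - (a' + b') \<in> I"
    and ideal_set_cong_diff: "a - b - (a' - b') \<in> I"
    and ideal_set_cong_mult: "a * b - a' * b' \<in> I"
proof -
  have "(a - a') + (b - b') \<in> I" "(a - a') - (b - b') \<in> I" "(a - a') * b + a' * (b - b') \<in> I"
    using I a b ideal_set_diff ideal_set_mult_right unfolding ideal_set_def by blast+
  then show "a + b - (a' + b') \<in> I" "a - b - (a' - b') \<in> I" "a * b - a' * b' \<in> I"
    by (simp_all add: algebra_simps)
qed

lemma ideal_set_cong_uminus: "ideal_set I \<Longrightarrow> a - a' \<in> I \<Longrightarrow> - a - - a' \<in> I"
  using ideal_set_uminus[of I "a - a'"] by simp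

text \<open>Types cannot depend on q, so all the quotient rings are collected in one product ring.\<close>
quotient_type gf_prod = "nat \<Rightarrow> int poly" / "\<lambda>f g. \<forall>q. f q - g q \<in> gf_ideal q"
proof (rule equivpI)
  show "reflp (\<lambda>f g. \<forall>q. f q - g q \<in> gf_ideal q)"
    using ideal_set_gf_ideal by (auto simp: reflp_def ideal_set_def)
  show "symp (\<lambda>f g. \<forall>q. f q - g q \<in> gf_ideal q)"
    using ideal_set_uminus[OF ideal_set_gf_ideal] by (intro sympI) (metis minus_diff_eq)
  show "transp (\<lambda>f g. \<forall>q. f q - g q \<in> gf_ideal q)"
  proof (rule transpI)
    fix f g h assume a: "\<forall>q. f q - g q \<in> gf_ideal q" "\<forall>q. g q - h q \<in> gf_ideal q"
    have "f q - h q = (f q - g q) + (g q - h q)" for q by simp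
    then show "\<forall>q. f q - h q \<in> gf_ideal q"
      using a ideal_set_gf_ideal unfolding ideal_set_def by metis
  qed
qed

instantiation gf_prod :: comm_ring_1
begin

lift_definition zero_gf_prod :: gf_prod is "\<lambda>_. 0" .
lift_definition one_gf_prod :: gf_prod is "\<lambda>_. 1" .

lift_definition plus_gf_prod :: "gf_prod \<Rightarrow> gf_prod \<Rightarrow> gf_prod" is "\<lambda>f g q. f q + g q"
  by (blast intro: ideal_set_cong_add ideal_set_gf_ideal)

lift_definition uminus_gf_prod :: "gf_prod \<Rightarrow> gf_prod" is "\<lambda>f q. - f q"
  by (blast intro: ideal_set_cong_uminus ideal_set_gf_ideal)

lift_definition minus_gf_prod :: "gf_prod \<Rightarrow> gf_prod \<Rightarrow> gf_prod" is "\<lambda>f g q. f q - g q"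
  by (blast intro: ideal_set_cong_diff ideal_set_gf_ideal)

lift_definition times_gf_prod :: "gf_prod \<Rightarrow> gf_prod \<Rightarrow> gf_prod" is "\<lambda>f g q. f q * g q"
  by (blast intro: ideal_set_cong_mult ideal_set_gf_ideal)

instance
proof
  show "(0::gf_prod) \<noteq> 1"
  proof transfer
    \<comment> \<open>One nontrivial component separates 0 from 1 in the product; the index 2
      provides it.\<close>
    have "primepow (2::nat)" by (rule primepow_prime) simp
    then have "1 \<notin> gf_ideal 2" using gf_ideal_spec[of 2] by (simp add: gf_ideal_spec_def)
    then show "\<not> (\<forall>q. 0 - 1 \<in> gf_ideal q)"
      using ideal_set_uminus[OF ideal_set_gf_ideal] by (metis diff_0 minus_minus)
  qed
qed (transfer; use ideal_set_gf_ideal in \<open>simp add: ideal_set_def algebra_simps\<close>)+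

end

text \<open>The inclusion of one factor into the product preserves sums and products but sends 1 to
  an idempotent. This is the origin of the unit \<open>e\<close> of the embedded field.\<close>

lift_definition gf_embed :: "nat \<Rightarrow> int poly \<Rightarrow> gf_prod" is "\<lambda>q f r. if r = q then f else 0" .

lemma gf_embed_eq_iff: "gf_embed q f = gf_embed q g \<longleftrightarrow> f - g \<in> gf_ideal q"
  by transfer (use ideal_set_gf_ideal in \<open>auto simp: ideal_set_def\<close>)

lemma gf_embed_0: "gf_embed q 0 = 0"
  by transfer (use ideal_set_gf_ideal in \<open>auto simp: ideal_set_def\<close>)

lemma gf_embed_add: "gf_embed q (f + g) = gf_embed q f + gf_embed q g"
  by transfer (use ideal_set_gf_ideal in \<open>auto simp: ideal_set_def\<close>)

lemma gf_embed_mult: "gf_embed q (f * g) = gf_embed q f * gf_embed q g"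
  by transfer (use ideal_set_gf_ideal in \<open>auto simp: ideal_set_def\<close>)

text \<open>A finite field with n + 1 elements sitting inside an ambient commutative ring, whose unit 1 need
  not be the unit e of the field; g generates the multiplicative group up to the factor e.\<close>
locale embedded_gf =
  fixes K :: "'a::comm_ring_1 set" and e g :: 'a and n :: nat
  assumes n_pos: "n > 0"
    and K_eq: "K = insert 0 ((\<lambda>j. e * g ^ j) ` {..<n})"
    and inj_pow: "inj_on (\<lambda>j. e * g ^ j) {..<n}"
    and pow_nonzero: "e * g ^ j \<noteq> 0"
    and pow_n: "e * g ^ n = e"
    and e_idem: "e * e = e"
    and K_add: "x \<in> K \<Longrightarrow> y \<in> K \<Longrightarrow> x + y \<in> K"

text \<open>The zero class and the powers of X are exactly the classes with f^q = f
  (\<open>K_iff\<close>). The first description shows the cyclic structure, the second gives closure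
  under addition by Frobenius.\<close>

lemma ex_embedded_gf:
  assumes "primepow q"
  shows "\<exists>(K :: gf_prod set) e g. embedded_gf K e g (q - 1)"
proof -
  define n where "n = q - 1"
  define X :: "int poly" where "X = [:0, 1:]"
  have q1: "q > 1" using primepow_gt_Suc_0[OF assms] by simp
  then have n: "n > 0" "q = Suc n" by (auto simp: n_def)
  note I = ideal_set_gf_ideal[of q]
  have 1: "X ^ n - 1 \<in> gf_ideal q"
    and 2: "\<And>d. 0 < d \<Longrightarrow> d < n \<Longrightarrow> X ^ d - 1 \<notin> gf_ideal q"
    and 3: "\<And>f. f ^ q - f \<in> gf_ideal q \<Longrightarrow> f \<in> gf_ideal q \<or> (\<exists>j<n. f - X ^ j \<in> gf_ideal q)"
    and 4: "\<And>f h. (f + h) ^ q - (f ^ q + h ^ q) \<in> gf_ideal q"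
    and 5: "1 \<notin> gf_ideal q"
    using gf_ideal_spec[of q] assms unfolding gf_ideal_spec_def X_def n_def by blast+
  define g where "g = gf_embed q X"
  define e where "e = gf_embed q 1"
  have eg: "e * g ^ j = gf_embed q (X ^ j)" for j
  proof (induction j)
    case 0
    then show ?case by (simp add: e_def)
  next
    case (Suc j)
    have "e * g ^ Suc j = g * (e * g ^ j)" by (simp add: algebra_simps)
    also have "\<dots> = gf_embed q (X ^ Suc j)" unfolding Suc.IH by (simp add: g_def gf_embed_mult)
    finally show ?case .
  qed
  have Xn: "X ^ (n * m) - 1 \<in> gf_ideal q" for m
    using ideal_set_power_diff[OF I 1, of m] by (simp add: power_mult)
  \<comment> \<open>X^(n j - j) is an inverse of X^j, since X^(n j) is 1 modulo the ideal.\<close>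
  have unit: "f \<in> gf_ideal q" if "X ^ j * f \<in> gf_ideal q" for j f
  proof -
    have "X ^ (n * j - j) * (X ^ j * f) \<in> gf_ideal q" using I that unfolding ideal_set_def by blast
    moreover have "j \<le> n * j" using n by simp
    ultimately have "X ^ (n * j) * f \<in> gf_ideal q"
      by (simp add: mult.assoc [symmetric] flip: power_add)
    then have "X ^ (n * j) * f - (X ^ (n * j) - 1) * f \<in> gf_ideal q"
      by (intro ideal_set_diff[OF I] ideal_set_mult_right[OF I Xn])
    then show ?thesis by (simp add: algebra_simps)
  qed
  define K where "K = insert 0 ((\<lambda>j. e * g ^ j) ` {..<n})"
  have K_iff: "gf_embed q f \<in> K \<longleftrightarrow> f ^ q - f \<in> gf_ideal q" for f
  proof
    assume "gf_embed q f \<in> K"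
    then consider "f \<in> gf_ideal q" | j where "f - X ^ j \<in> gf_ideal q"
      unfolding K_def eg by (auto simp: gf_embed_eq_iff simp flip: gf_embed_0[of q])
    then show "f ^ q - f \<in> gf_ideal q"
    proof cases
      case 1
      then have "f * (f ^ n - 1) \<in> gf_ideal q" by (rule ideal_set_mult_right[OF I])
      then show ?thesis by (simp add: n(2) algebra_simps)
    next
      case (2 j)
      have "f ^ q - (X ^ j) ^ q \<in> gf_ideal q" by (rule ideal_set_power_diff[OF I 2])
      moreover have "(X ^ j) ^ q - X ^ j \<in> gf_ideal q"
      proof -
        have "(X ^ (n * j) - 1) * X ^ j \<in> gf_ideal q" by (rule ideal_set_mult_right[OF I Xn])
        then show ?thesis by (simp add: n(2) algebra_simps power_add flip: power_mult)
      qed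
      ultimately have "(f ^ q - (X ^ j) ^ q) + ((X ^ j) ^ q - X ^ j) \<in> gf_ideal q"
        using I unfolding ideal_set_def by blast
      from ideal_set_diff[OF I this 2] show ?thesis by simp
    qed
  next
    assume "f ^ q - f \<in> gf_ideal q"
    from 3[OF this] show "gf_embed q f \<in> K"
      unfolding K_def eg by (auto simp: gf_embed_eq_iff simp flip: gf_embed_0[of q])
  qed
  have K_ex: "\<exists>f. x = gf_embed q f" if "x \<in> K" for x
    using that unfolding K_def eg by (auto simp flip: gf_embed_0[of q])
  have "embedded_gf K e g n"
  proof
    show "n > 0" by (rule n)
    show "K = insert 0 ((\<lambda>j. e * g ^ j) ` {..<n})" by (rule K_def)
    show "inj_on (\<lambda>j. e * g ^ j) {..<n}"
    proof (rule linorder_inj_onI)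
      fix i j assume ij: "i < j" "i \<in> {..<n}" "j \<in> {..<n}"
      show "e * g ^ i \<noteq> e * g ^ j"
      proof
        assume "e * g ^ i = e * g ^ j"
        then have "X ^ j - X ^ i \<in> gf_ideal q" unfolding eg gf_embed_eq_iff[symmetric] by simp
        then have "X ^ i * (X ^ (j - i) - 1) \<in> gf_ideal q"
          using ij(1) by (simp add: algebra_simps flip: power_add)
        then have "X ^ (j - i) - 1 \<in> gf_ideal q" by (rule unit)
        then show False using 2[of "j - i"] ij by (simp add: less_imp_diff_less)
      qed
    qed auto
    show "e * g ^ j \<noteq> 0" for j
    proof
      assume "e * g ^ j = 0"
      then have "X ^ j * 1 \<in> gf_ideal q" using gf_embed_eq_iff[of q "X ^ j" 0] by (simp add: eg gf_embed_0)
      then show False using unit 5 by blast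
    qed
    show "e * g ^ n = e" unfolding eg unfolding e_def by (simp add: gf_embed_eq_iff 1)
    show "e * e = e" by (simp add: e_def flip: gf_embed_mult)
    show "x + y \<in> K" if xy: "x \<in> K" "y \<in> K" for x y
    proof -
      obtain f h where fh: "x = gf_embed q f" "y = gf_embed q h" using K_ex xy by metis
      then have a: "f ^ q - f \<in> gf_ideal q" "h ^ q - h \<in> gf_ideal q" using xy K_iff by auto
      have "((f + h) ^ q - (f ^ q + h ^ q)) + ((f ^ q - f) + (h ^ q - h)) \<in> gf_ideal q"
        using 4 a I unfolding ideal_set_def by blast
      then have "(f + h) ^ q - (f + h) \<in> gf_ideal q" by (simp add: algebra_simps)
          then show ?thesis unfolding fh gf_embed_add[symmetric] K_iff .
    qed
  qed
  then show ?thesis unfolding n_def by blast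
qed

section \<open>Arithmetic of the embedded field\<close>

context embedded_gf
begin

lemma zero_in_K: "0 \<in> K" by (simp add: K_eq)

lemma pow_mod: "e * g ^ j = e * g ^ (j mod n)"
proof -
  have "e * g ^ (n * m + r) = e * g ^ r" for m r
  proof (induction m)
    case (Suc m)
    have "e * g ^ (n * Suc m + r) = (e * g ^ n) * g ^ (n * m + r)"
      by (simp add: power_add algebra_simps)
    then show ?case using Suc pow_n by simp
  qed simp
  then show ?thesis by (metis mult_div_mod_eq)
qed

lemma pow_in_K: "e * g ^ j \<in> K"
  unfolding pow_mod[of j] K_eq using n_pos by simp

lemma pow_eq_iff: "e * g ^ i = e * g ^ j \<longleftrightarrow> i mod n = j mod n"
  using inj_pow n_pos unfolding pow_mod[of i] pow_mod[of j] inj_on_def by auto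

lemma nonzero_pow: "x \<in> K \<Longrightarrow> x \<noteq> 0 \<Longrightarrow> \<exists>j. x = e * g ^ j"
  unfolding K_eq by blast

lemma pow_mult: "(e * g ^ i) * (e * g ^ j) = e * g ^ (i + j)"
proof -
  have "(e * g ^ i) * (e * g ^ j) = (e * e) * g ^ (i + j)" by (simp add: power_add algebra_simps)
  then show ?thesis by (simp add: e_idem)
qed

lemma finite_K: "finite K" by (simp add: K_eq)

lemma card_K: "card K = n + 1"
proof -
  have "0 \<notin> (\<lambda>j. e * g ^ j) ` {..<n}" using pow_nonzero by (metis imageE)
  then show ?thesis unfolding K_eq by (simp add: card_image inj_pow)
qed

lemma e_in_K: "e \<in> K" using pow_in_K[of 0] by simp

lemma e_nonzero: "e \<noteq> 0" using pow_nonzero[of 0] by simp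

lemma e_mult: "x \<in> K \<Longrightarrow> e * x = x"
  unfolding K_eq by (auto simp: e_idem simp flip: mult.assoc)

lemma K_mult: "x \<in> K \<Longrightarrow> y \<in> K \<Longrightarrow> x * y \<in> K"
  using nonzero_pow[of x] nonzero_pow[of y] zero_in_K
  by (cases "x = 0"; cases "y = 0") (auto simp: pow_mult pow_in_K)

lemma K_mult_nonzero: "x \<in> K \<Longrightarrow> y \<in> K \<Longrightarrow> x \<noteq> 0 \<Longrightarrow> y \<noteq> 0 \<Longrightarrow> x * y \<noteq> 0"
  using nonzero_pow pow_mult pow_nonzero by metis

text \<open>Translation by x is an injective map of the finite set K into itself, so it reaches
  0.\<close>

lemma K_uminus: assumes "x \<in> K" shows "- x \<in> K"
proof -
  have "inj_on ((+) x) K" by simp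
  moreover have "(+) x ` K \<subseteq> K" using K_add assms by auto
  ultimately have "(+) x ` K = K" using endo_inj_surj[OF finite_K] by blast
  then obtain y where "y \<in> K" "x + y = 0" using zero_in_K by (metis imageE)
  then show ?thesis by (metis minus_unique)
qed

lemma K_diff: "x \<in> K \<Longrightarrow> y \<in> K \<Longrightarrow> x - y \<in> K"
  using K_add K_uminus by (metis uminus_add_conv_diff add.commute)

lemma K_sum: "(\<And>i. i \<in> A \<Longrightarrow> f i \<in> K) \<Longrightarrow> sum f A \<in> K"
  by (induction A rule: infinite_finite_induct) (auto simp: zero_in_K K_add)

lemma K_cancel: "c \<in> K \<Longrightarrow> c \<noteq> 0 \<Longrightarrow> x \<in> K \<Longrightarrow> y \<in> K \<Longrightarrow> c * x = c * y \<Longrightarrow> x = y"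
  using K_mult_nonzero[of c "x - y"] K_diff by (auto simp: algebra_simps)

end

section \<open>Odd order of the field: signs and discrete logarithms\<close>

locale odd_embedded_gf = embedded_gf +
  fixes m :: nat
  assumes n_eq: "n = 2 * m"
begin

lemma m_pos: "m > 0" using n_pos n_eq by simp

lemma pow_half: "e * g ^ m = - e"
proof -
  have "(e * g ^ m - e) * (e * g ^ m + e) = (e * e) * g ^ (m + m) - e * e"
    by (simp add: algebra_simps power_add)
  also have "\<dots> = 0" using pow_n by (simp add: e_idem n_eq mult_2)
  finally have 0: "(e * g ^ m - e) * (e * g ^ m + e) = 0" .
  have "e * g ^ m \<noteq> e * g ^ 0" unfolding pow_eq_iff using m_pos by (simp add: n_eq)
  then have "e * g ^ m - e \<noteq> 0" by simp
  then have "e * g ^ m + e = 0"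
    using 0 K_mult_nonzero K_diff K_add pow_in_K e_in_K by meson
  then show ?thesis by (simp add: eq_neg_iff_add_eq_0)
qed

lemma minus_pow: "- (e * g ^ j) = e * g ^ (j + m)"
proof -
  have "e * g ^ (j + m) = (e * g ^ m) * g ^ j" by (simp add: power_add algebra_simps)
  then show ?thesis unfolding pow_half by simp
qed

text \<open>A change of sign shifts the exponent by m, half the order of g. All later sign
  ambiguities thus become congruences modulo m.\<close>

lemma pow_eq_pm_iff: "e * g ^ i = e * g ^ j \<or> e * g ^ i = - (e * g ^ j) \<longleftrightarrow> i mod m = j mod m"
proof -
  have "i mod (2 * m) = j mod (2 * m) \<or> i mod (2 * m) = (j + m) mod (2 * m) \<longleftrightarrow> i mod m = j mod m"
  proof
    have mm: "a mod (2 * m) mod m = a mod m" for a by (simp add: mod_mod_cancel)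
    assume "i mod (2 * m) = j mod (2 * m) \<or> i mod (2 * m) = (j + m) mod (2 * m)"
    then have "i mod (2 * m) mod m = j mod (2 * m) mod m \<or> i mod (2 * m) mod m = (j + m) mod (2 * m) mod m" by metis
    then show "i mod m = j mod m" unfolding mm by simp
  next
    assume a: "i mod m = j mod m"
    \<comment> \<open>A residue modulo m has two lifts modulo 2 m. Both j and j + m lift the residue
      of i and they differ, so i must agree with one of them.\<close>
    have half: "a mod (2 * m) = a mod m \<or> a mod (2 * m) = a mod m + m" for a
    proof -
      have "a mod (m * 2) = m * (a div m mod 2) + a mod m" by (rule mod_mult2_eq)
      moreover have "a div m mod 2 = 0 \<or> a div m mod 2 = 1" by linarith
      ultimately show ?thesis by (auto simp: mult.commute)
    qed
    have "(j + m) mod m = i mod m" "j mod m = i mod m" using a by simp_all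
    moreover have "(j + m) mod (2 * m) \<noteq> j mod (2 * m)"
    proof
      assume "(j + m) mod (2 * m) = j mod (2 * m)"
      then have "2 * m dvd (j + m) - j" by (metis mod_eq_dvd_iff_nat le_add1)
      then show False using m_pos by (auto dest: dvd_imp_le)
    qed
    ultimately show "i mod (2 * m) = j mod (2 * m) \<or> i mod (2 * m) = (j + m) mod (2 * m)"
      using half[of i] half[of j] half[of "j + m"] by metis
  qed
  then show ?thesis unfolding minus_pow pow_eq_iff n_eq .
qed

lemma neq_minus: assumes "x \<in> K" "x \<noteq> 0" shows "x \<noteq> - x"
proof -
  obtain j where j: "x = e * g ^ j" using nonzero_pow assms by blast
  have "(j + m) mod (2 * m) \<noteq> j mod (2 * m)"
  proof
    assume "(j + m) mod (2 * m) = j mod (2 * m)"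
    then have "2 * m dvd (j + m) - j" by (metis mod_eq_dvd_iff_nat le_add1)
    then show False using m_pos by (auto dest: dvd_imp_le)
  qed
  then show ?thesis unfolding j minus_pow pow_eq_iff n_eq by simp
qed

end

section \<open>Cycle systems from affine images of one cycle\<close>

text \<open>Continuing the vertex sequence by v k = v 0 removes the reduction of indices modulo k,
  so every edge becomes a step from i to \<open>Suc i\<close>.\<close>

lemma cycle_edges_map:
  assumes "k > 0" "v k = v 0"
  shows "cycle_edges (map v [0..<k]) = (\<lambda>i. {v i, v (Suc i)}) ` {..<k}"
proof -
  have "v (Suc i mod k) = v (Suc i)" if "i < k" for i
    using that assms by (cases "Suc i = k") auto
  then have "(\<lambda>i. {map v [0..<k] ! i, map v [0..<k] ! (Suc i mod k)}) ` {..<k} = (\<lambda>i. {v i, v (Suc i)}) ` {..<k}"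
    using assms(1) by (intro image_cong) auto
  moreover have "cycle_edges (map v [0..<k])
      = (\<lambda>i. {map v [0..<k] ! i, map v [0..<k] ! (Suc i mod k)}) ` {..<k}"
    unfolding cycle_edges_def
    by (simp only: Setcompr_eq_image[symmetric] lessThan_iff length_map length_upt diff_zero Suc_eq_plus1)
  ultimately show ?thesis by simp
qed

text \<open>The map \<open>h\<close> carries field elements to the prescribed vertices; all
  arithmetic happens before it is applied.\<close>

definition affine_cycle :: "('a::comm_ring_1 \<Rightarrow> 'b) \<Rightarrow> nat \<Rightarrow> (nat \<Rightarrow> 'a) \<Rightarrow> 'a \<Rightarrow> 'a \<Rightarrow> 'b set set" where
  "affine_cycle h k v t x = cycle_edges (map (\<lambda>i. h (x + t * v i)) [0..<k])"

definition affine_system ::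
  "('a::comm_ring_1 \<Rightarrow> 'b) \<Rightarrow> 'a set \<Rightarrow> nat \<Rightarrow> (nat \<Rightarrow> 'a) \<Rightarrow> 'a set \<Rightarrow> 'b set set set" where
  "affine_system h K k v T = (\<lambda>(t, x). affine_cycle h k v t x) ` (T \<times> K)"

lemma affine_cycle_eq:
  assumes "k > 0" "v k = v 0"
  shows "affine_cycle h k v t x = (\<lambda>i. {h (x + t * v i), h (x + t * v (Suc i))}) ` {..<k}"
  unfolding affine_cycle_def using cycle_edges_map[OF assms(1), of "\<lambda>i. h (x + t * v i)"] assms(2) by simp

context odd_embedded_gf
begin

text \<open>The two alternatives are the two orientations. In the reversed one the opposite
  differences alone are recorded: they suffice for the contradictions and for the orthogonality
  criterion.\<close>

lemma affine_edge_eq_cases: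
  assumes h: "inj_on h K"
    and K: "x \<in> K" "y \<in> K" "t \<in> K" "s \<in> K" "a \<in> K" "b \<in> K" "c \<in> K" "d \<in> K"
    and eq: "{h (x + t * a), h (x + t * b)} = {h (y + s * c), h (y + s * d)}"
  shows "(x + t * a = y + s * c \<and> t * (b - a) = s * (d - c)) \<or> t * (b - a) = - (s * (d - c))"
proof -
  have "x + t * a \<in> K" "x + t * b \<in> K" "y + s * c \<in> K" "y + s * d \<in> K"
    using K K_add K_mult by blast+
  then have "(x + t * a = y + s * c \<and> x + t * b = y + s * d) \<or> (x + t * a = y + s * d \<and> x + t * b = y + s * c)"
    using eq h unfolding doubleton_eq_iff by (metis inj_onD)
  then show ?thesis
  proof
    assume a: "x + t * a = y + s * c \<and> x + t * b = y + s * d"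
    have "t * (b - a) = (x + t * b) - (x + t * a)" by (simp add: algebra_simps)
    also have "\<dots> = s * (d - c)" using a by (simp add: algebra_simps)
    finally show ?thesis using a by blast
  next
    assume a: "x + t * a = y + s * d \<and> x + t * b = y + s * c"
    have "t * (b - a) = (x + t * b) - (x + t * a)" by (simp add: algebra_simps)
    also have "\<dots> = - (s * (d - c))" using a by (simp add: algebra_simps)
    finally show ?thesis by blast
  qed
qed

text \<open>The k \<open>card T\<close> = m scaled differences and their negatives are n distinct
  nonzero elements, hence all of them. An edge therefore determines its orientation, t and i by its
  difference, and then x by its first endpoint.\<close>

lemma k_cycle_system_affine:
  assumes h: "bij_betw h K V"
    and k: "k \<ge> 3" "v k = v 0" and v: "\<And>i. v i \<in> K" and inj: "inj_on v {..<k}"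
    and T: "T \<subseteq> K - {0}" and card: "k * card T = m"
    and d: "\<And>t t' i j. t \<in> T \<Longrightarrow> t' \<in> T \<Longrightarrow> i < k \<Longrightarrow> j < k \<Longrightarrow>
        t * (v (Suc i) - v i) = t' * (v (Suc j) - v j) \<or> t * (v (Suc i) - v i) = - (t' * (v (Suc j) - v j)) \<Longrightarrow>
        t = t' \<and> i = j"
  shows "k_cycle_system k V (affine_system h K k v T)"
proof -
  have k0: "k > 0" using k by simp
  have hinj: "inj_on h K" and himg: "h ` K = V" using h by (auto simp: bij_betw_def)
  have finT: "finite T" using T finite_K by (meson finite_Diff finite_subset)
  have TK: "t \<in> K" "t \<noteq> 0" if "t \<in> T" for t using that T by auto
  have mem: "x + t * v i \<in> K" if "x \<in> K" "t \<in> T" for x t i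
    using that TK v K_add K_mult by blast
  define df where "df i = v (Suc i) - v i" for i
  have df_K: "df i \<in> K" for i unfolding df_def by (simp add: K_diff v)
  have df0: "df i \<noteq> 0" if "i < k" for i
  proof
    assume "df i = 0"
    then have "v (Suc i) = v i" by (simp add: df_def)
    moreover have "v (Suc i) \<noteq> v i"
    proof (cases "Suc i = k")
      case True
      then show ?thesis using k inj that unfolding inj_on_def by force
    next
      case False
      then show ?thesis using inj that unfolding inj_on_def by force
    qed
    ultimately show False by simp
  qed
  have td: "t * df i \<in> K" "t * df i \<noteq> 0" if "t \<in> T" "i < k" for t i
    using that TK df_K df0 K_mult K_mult_nonzero by blast+
  have d': "t = t' \<and> i = j" if "t \<in> T" "t' \<in> T" "i < k" "j < k" "t * df i = t' * df j \<or> t * df i = - (t' * df j)" for t t' i j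
    using d that unfolding df_def by blast
  \<comment> \<open>The hypothesis on differences still permits equal indices in the negative case;
    that would make a nonzero element its own negative.\<close>
  have d'': "t * df i \<noteq> - (t' * df j)" if a: "t \<in> T" "t' \<in> T" "i < k" "j < k" for t t' i j
  proof
    assume e: "t * df i = - (t' * df j)"
    then have "t = t' \<and> i = j" using d' a by blast
    then show False using e neq_minus td a by metis
  qed

  define E where "E = (\<lambda>(t, i). t * df i) ` (T \<times> {..<k})"
  have "inj_on (\<lambda>(t, i). t * df i) (T \<times> {..<k})"
    using d' by (auto simp: inj_on_def)
  then have "card E = m" unfolding E_def using card by (simp add: card_image card_cartesian_product mult.commute)
  have finE: "finite E" unfolding E_def using finT by simp
  have "E \<inter> uminus ` E = {}" unfolding E_def using d'' by auto
  then have "card (E \<union> uminus ` E) = n"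
    using \<open>card E = m\<close> finE by (subst card_Un_disjoint) (auto simp: card_image n_eq)
  moreover have "E \<union> uminus ` E \<subseteq> K - {0}" unfolding E_def using td K_uminus by auto
  moreover have "card (K - {0}) = n" using card_K zero_in_K finite_K by simp
  ultimately have Eall: "E \<union> uminus ` E = K - {0}"
    using finite_K by (metis card_subset_eq finite_Diff)

  have cyc: "affine_cycle h k v t x = (\<lambda>i. {h (x + t * v i), h (x + t * v (Suc i))}) ` {..<k}" for t x
    by (rule affine_cycle_eq[OF k0 k(2)])

  show ?thesis unfolding k_cycle_system_def
  proof (intro conjI ballI impI)
    fix C assume "C \<in> affine_system h K k v T"
    then obtain t x where tx: "t \<in> T" "x \<in> K" "C = affine_cycle h k v t x" unfolding affine_system_def by auto
    have "inj_on (\<lambda>i. h (x + t * v i)) {..<k}"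
    proof (rule inj_onI)
      fix i j assume ij: "i \<in> {..<k}" "j \<in> {..<k}" and "h (x + t * v i) = h (x + t * v j)"
      then have "x + t * v i = x + t * v j" using hinj mem tx by (metis inj_onD)
      then have "v i = v j" using K_cancel[of t "v i" "v j"] TK tx v by simp
      then show "i = j" using inj ij by (metis inj_onD)
    qed
    then show "is_k_cycle k C" unfolding is_k_cycle_def tx(3) affine_cycle_def
      by (intro exI[of _ "map (\<lambda>i. h (x + t * v i)) [0..<k]"]) (simp add: distinct_map atLeast0LessThan)
  next
    fix C C' assume C: "C \<in> affine_system h K k v T" and C': "C' \<in> affine_system h K k v T" and "C \<noteq> C'"
    from C obtain t x where tx: "t \<in> T" "x \<in> K" "C = affine_cycle h k v t x" unfolding affine_system_def by auto
    from C' obtain t' x' where tx': "t' \<in> T" "x' \<in> K" "C' = affine_cycle h k v t' x'" unfolding affine_system_def by auto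
    show "C \<inter> C' = {}"
    proof (rule ccontr)
      assume "C \<inter> C' \<noteq> {}"
      then obtain i j where ij: "i < k" "j < k"
        "{h (x + t * v i), h (x + t * v (Suc i))} = {h (x' + t' * v j), h (x' + t' * v (Suc j))}"
        unfolding tx(3) tx'(3) cyc by auto
      from affine_edge_eq_cases[OF hinj tx(2) tx'(2) TK(1)[OF tx(1)] TK(1)[OF tx'(1)] v v v v ij(3)]
      have "x + t * v i = x' + t' * v j \<and> t * df i = t' * df j" using d'' tx(1) tx'(1) ij unfolding df_def by blast
      moreover have "t = t' \<and> i = j" using calculation d' tx(1) tx'(1) ij by blast
      ultimately have "C = C'" using tx(3) tx'(3) by simp
      then show False using \<open>C \<noteq> C'\<close> by simp
    qed
  next
    show "\<Union> (affine_system h K k v T) = complete_edges V"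
    proof
      show "\<Union> (affine_system h K k v T) \<subseteq> complete_edges V"
      proof
        fix A assume "A \<in> \<Union> (affine_system h K k v T)"
        then obtain t x i where *: "t \<in> T" "x \<in> K" "i < k" "A = {h (x + t * v i), h (x + t * v (Suc i))}"
          unfolding affine_system_def by (auto simp: cyc)
        have "x + t * v i \<noteq> x + t * v (Suc i)"
          using td[OF *(1,3)] by (auto simp: df_def algebra_simps)
        then have "h (x + t * v i) \<noteq> h (x + t * v (Suc i))" using hinj mem * by (metis inj_onD)
        then show "A \<in> complete_edges V" unfolding complete_edges_def
          using mem[OF *(2,1)] himg *(4) by blast
      qed
      show "complete_edges V \<subseteq> \<Union> (affine_system h K k v T)"
      proof
        fix A assume "A \<in> complete_edges V"
        then obtain y z where yz: "y \<in> K" "z \<in> K" "y \<noteq> z" "A = {h y, h z}"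
          unfolding complete_edges_def himg[symmetric] by blast
        \<comment> \<open>The edge is oriented so that its difference lies in E rather than in its
          negative.\<close>
        have key: "{h y, h z} \<in> \<Union> (affine_system h K k v T)" if a: "y \<in> K" "z \<in> K" "z - y \<in> E" for y z
        proof -
          obtain t i where ti: "t \<in> T" "i < k" "z - y = t * df i" using a(3) unfolding E_def by auto
          define x where "x = y - t * v i"
          have xK: "x \<in> K" unfolding x_def using a ti TK v K_mult K_diff by blast
          have "y = x + t * v i" by (simp add: x_def)
          moreover have "z = y + t * df i" using ti(3) by (simp add: algebra_simps)
          then have "z = x + t * v (Suc i)" by (simp add: x_def df_def algebra_simps)
          ultimately have "{h y, h z} \<in> affine_cycle h k v t x" unfolding cyc using ti(2) by blast
          then show ?thesis unfolding affine_system_def using ti xK by blast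
        qed
        have "z - y \<in> K - {0}" using yz K_diff by simp
        then have "z - y \<in> E \<or> (\<exists>u\<in>E. z - y = - u)" using Eall by blast
        moreover have "u = y - z" if "z - y = - u" for u using that by (metis minus_diff_eq minus_minus)
        ultimately consider "z - y \<in> E" | "y - z \<in> E" by blast
        then show "A \<in> \<Union> (affine_system h K k v T)"
        proof cases
          case 1 then show ?thesis using key yz by blast
        next
          case 2 then show ?thesis using key[of z y] yz by (simp add: insert_commute)
        qed
      qed
    qed
  qed
qed

text \<open>Translations disappear in differences. Two common edges give t p_i = s r_a and t p_j = s
  r_b up to sign, and cross-multiplication eliminates the scalars t and s.\<close>

lemma orthogonal_systems_affine:
  assumes h: "inj_on h K"
    and k: "k > 0" "v k = v 0" "u k = u 0" and v: "\<And>i. v i \<in> K" and u: "\<And>i. u i \<in> K"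
    and T: "T \<subseteq> K - {0}"
    and c: "\<And>i j a b. i < k \<Longrightarrow> j < k \<Longrightarrow> a < k \<Longrightarrow> b < k \<Longrightarrow> i \<noteq> j \<Longrightarrow> a \<noteq> b \<Longrightarrow>
        (v (Suc i) - v i) * (u (Suc b) - u b) \<noteq> (v (Suc j) - v j) * (u (Suc a) - u a) \<and>
        (v (Suc i) - v i) * (u (Suc b) - u b) \<noteq> - ((v (Suc j) - v j) * (u (Suc a) - u a))"
  shows "orthogonal_systems (affine_system h K k v T) (affine_system h K k u T)"
  unfolding orthogonal_systems_def
proof (intro ballI)
  fix C C' assume C: "C \<in> affine_system h K k v T" and C': "C' \<in> affine_system h K k u T"
  from C obtain t x where tx: "t \<in> T" "x \<in> K" "C = affine_cycle h k v t x" unfolding affine_system_def by auto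
  from C' obtain s y where sy: "s \<in> T" "y \<in> K" "C' = affine_cycle h k u s y" unfolding affine_system_def by auto
  have ts: "t \<in> K" "s \<in> K" "t * s \<in> K" "t * s \<noteq> 0"
    using tx sy T K_mult K_mult_nonzero by blast+
  have C1: "C = (\<lambda>i. {h (x + t * v i), h (x + t * v (Suc i))}) ` {..<k}"
    unfolding tx by (rule affine_cycle_eq[OF k(1,2)])
  have C2: "C' = (\<lambda>i. {h (y + s * u i), h (y + s * u (Suc i))}) ` {..<k}"
    unfolding sy by (rule affine_cycle_eq[OF k(1,3)])
  show "card (C \<inter> C') \<le> 1"
  proof (rule ccontr)
    assume "\<not> card (C \<inter> C') \<le> 1"
    then have "card (C \<inter> C') \<ge> 2" by simp
    then obtain A B where AB: "A \<in> C \<inter> C'" "B \<in> C \<inter> C'" "A \<noteq> B"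
      by (metis card_le_Suc0_iff_eq not_less_eq_eq numeral_2_eq_2 card.infinite not_less_zero le_zero_eq nat.simps(3))
    obtain i a where ia: "i < k" "a < k" "A = {h (x + t * v i), h (x + t * v (Suc i))}" "A = {h (y + s * u a), h (y + s * u (Suc a))}"
      using AB(1) unfolding C1 C2 by blast
    obtain j b where jb: "j < k" "b < k" "B = {h (x + t * v j), h (x + t * v (Suc j))}" "B = {h (y + s * u b), h (y + s * u (Suc b))}"
      using AB(2) unfolding C1 C2 by blast
    have ne: "i \<noteq> j" "a \<noteq> b" using ia jb AB(3) by auto
    define p where "p i = v (Suc i) - v i" for i
    define r where "r i = u (Suc i) - u i" for i
    have K: "p i \<in> K" "r i \<in> K" for i unfolding p_def r_def using v u K_diff by auto
    have 1: "t * p i = s * r a \<or> t * p i = - (s * r a)"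
      unfolding p_def r_def using affine_edge_eq_cases[OF h tx(2) sy(2) ts(1,2) v v u u, of i "Suc i" a "Suc a"] ia by auto
    have 2: "t * p j = s * r b \<or> t * p j = - (s * r b)"
      unfolding p_def r_def using affine_edge_eq_cases[OF h tx(2) sy(2) ts(1,2) v v u u, of j "Suc j" b "Suc b"] jb by auto
    have "(t * p i) * (s * r b) = (t * p j) * (s * r a) \<or> (t * p i) * (s * r b) = - ((t * p j) * (s * r a))"
    proof -
      have "a * d = b * c \<or> a * d = - (b * c)" if "a = c \<or> a = - c" "b = d \<or> b = - d" for a b c d :: 'a
        using that by (auto simp: mult.commute)
      then show ?thesis using 1 2 by blast
    qed
    then have "(t * s) * (p i * r b) = (t * s) * (p j * r a) \<or> (t * s) * (p i * r b) = (t * s) * (- (p j * r a))"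
      by (simp add: algebra_simps)
    then have "p i * r b = p j * r a \<or> p i * r b = - (p j * r a)"
      using K_cancel[OF ts(3,4)] K K_mult K_uminus by meson
    then show False using c[OF ia(1) jb(1) ia(2) jb(2) ne] unfolding p_def r_def by blast
  qed
qed

end

section \<open>Sums of three cosets\<close>

text \<open>Averaging over all dilates c B replaces character sums: summed over c, the variance of the number of
  representations is computed exactly, and it is the same for all c that map B to itself.\<close>

context embedded_gf
begin

definition reps :: "'a set \<Rightarrow> 'a set \<Rightarrow> 'a \<Rightarrow> 'a \<Rightarrow> nat" where
  "reps A B c x = card {(a, b). a \<in> A \<and> b \<in> B \<and> a + c * b = x}"

lemma finite_reps: "A \<subseteq> K \<Longrightarrow> B \<subseteq> K \<Longrightarrow> finite {(a, b). a \<in> A \<and> b \<in> B \<and> P a b}"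
  by (rule finite_subset[of _ "K \<times> K"]) (auto simp: finite_K)

lemma sum_reps:
  assumes A: "A \<subseteq> K" and B: "B \<subseteq> K" and c: "c \<in> K"
  shows "(\<Sum>x\<in>K. reps A B c x) = card A * card B"
proof -
  have mem: "a + c * b \<in> K" if "a \<in> A" "b \<in> B" for a b
    using that A B c K_add K_mult by blast
  have "(\<Sum>x\<in>K. reps A B c x) = card (\<Union>x\<in>K. {(a, b). a \<in> A \<and> b \<in> B \<and> a + c * b = x})"
    unfolding reps_def using finite_reps[OF A B]
    by (subst card_UN_disjoint) (auto simp: finite_K)
  also have "(\<Union>x\<in>K. {(a, b). a \<in> A \<and> b \<in> B \<and> a + c * b = x}) = A \<times> B"
    using mem by auto
  finally show ?thesis by (simp add: card_cartesian_product)
qed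

text \<open>The second moment is the additive energy of A and c B.\<close>

lemma sum_reps_square:
  assumes A: "A \<subseteq> K" and B: "B \<subseteq> K" and c: "c \<in> K"
  shows "(\<Sum>x\<in>K. (reps A B c x)^2) = card {((a, b), (a', b')) \<in> (A \<times> B) \<times> (A \<times> B). a + c * b = a' + c * b'}"
proof -
  have mem: "a + c * b \<in> K" if "a \<in> A" "b \<in> B" for a b
    using that A B c K_add K_mult by blast
  let ?R = "\<lambda>x. {(a, b). a \<in> A \<and> b \<in> B \<and> a + c * b = x}"
  have "(\<Sum>x\<in>K. (reps A B c x)^2) = (\<Sum>x\<in>K. card (?R x \<times> ?R x))"
    unfolding reps_def by (simp add: card_cartesian_product power2_eq_square)
  also have "\<dots> = card (\<Union>x\<in>K. ?R x \<times> ?R x)"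
    using finite_reps[OF A B] by (subst card_UN_disjoint) (auto simp: finite_K)
  also have "(\<Union>x\<in>K. ?R x \<times> ?R x) = {((a, b), (a', b')) \<in> (A \<times> B) \<times> (A \<times> B). a + c * b = a' + c * b'}"
    using mem by auto
  finally show ?thesis .
qed

text \<open>Count by quadruples: the equation is c (b - b') = a' - a. A trivial quadruple admits all
  n values of c; any other admits at most one, and none unless both coordinates differ.\<close>

lemma sum_energy_le:
  assumes A: "A \<subseteq> K" and B: "B \<subseteq> K"
  shows "(\<Sum>c\<in>K-{0}. \<Sum>x\<in>K. (reps A B c x)^2) \<le> card A * card B * n + card A * (card A - 1) * (card B * (card B - 1))"
proof -
  have fin: "finite A" "finite B" using A B finite_K finite_subset by auto
  define Q where "Q = {((a, b), (a', b')). a \<in> A \<and> b \<in> B \<and> a' \<in> A \<and> b' \<in> B \<and> a \<noteq> a' \<and> b \<noteq> b'}"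
  define sol where "sol c = (\<lambda>((a, b), (a', b')). a + c * b = a' + c * b')" for c :: 'a
  let ?S = "(A \<times> B) \<times> (A \<times> B)"
  have finS: "finite ?S" using fin by simp
  have "(\<Sum>x\<in>K. (reps A B c x)^2) = (\<Sum>z\<in>?S. if sol c z then 1 else 0)" if "c \<in> K - {0}" for c
  proof -
    have "{((a, b), (a', b')) \<in> ?S. a + c * b = a' + c * b'} = {z \<in> ?S. sol c z}" unfolding sol_def by auto
    then show ?thesis using sum_reps_square[OF A B, of c] that finS by (simp add: sum.If_cases Int_def)
  qed
  then have "(\<Sum>c\<in>K-{0}. \<Sum>x\<in>K. (reps A B c x)^2) = (\<Sum>c\<in>K-{0}. \<Sum>z\<in>?S. if sol c z then 1 else 0)"
    by (intro sum.cong) auto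
  also have "\<dots> = (\<Sum>z\<in>?S. \<Sum>c\<in>K-{0}. if sol c z then 1 else 0)" by (rule sum.swap)
  also have "\<dots> = (\<Sum>z\<in>?S. card {c \<in> K - {0}. sol c z})"
    using finite_K by (intro sum.cong) (auto simp: sum.If_cases Int_def)
  also have "\<dots> \<le> (\<Sum>z\<in>?S. (if fst z = snd z then n else 0) + (if z \<in> Q then 1 else 0))"
  proof (rule sum_mono)
    fix z assume "z \<in> ?S"
    then obtain a b a' b' where z: "z = ((a, b), (a', b'))" "a \<in> A" "b \<in> B" "a' \<in> A" "b' \<in> B" by auto
    then have zK: "a \<in> K" "b \<in> K" "a' \<in> K" "b' \<in> K" using A B by auto
    have eq: "sol c z \<longleftrightarrow> c * (b - b') = a' - a" for c
      unfolding sol_def z(1) by (auto simp: algebra_simps)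
    show "card {c \<in> K - {0}. sol c z} \<le> (if fst z = snd z then n else 0) + (if z \<in> Q then 1 else 0)"
    proof (cases "fst z = snd z")
      case True
      have "card {c \<in> K - {0}. sol c z} \<le> card (K - {0})" using finite_K by (intro card_mono) auto
      also have "\<dots> = n" using card_K zero_in_K finite_K by simp
      finally show ?thesis using True by simp
    next
      case False
      show ?thesis
      proof (cases "a \<noteq> a' \<and> b \<noteq> b'")
        case True
        have "card {c \<in> K - {0}. sol c z} \<le> Suc 0"
        proof (rule card_le_Suc0_iff_eq[THEN iffD2])
          show "finite {c \<in> K - {0}. sol c z}" using finite_K by simp
          show "\<forall>c\<in>{c \<in> K - {0}. sol c z}. \<forall>d\<in>{c \<in> K - {0}. sol c z}. c = d"
          proof (intro ballI)
            fix c d assume cd: "c \<in> {c \<in> K - {0}. sol c z}" "d \<in> {c \<in> K - {0}. sol c z}"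
            then have "(b - b') * c = (b - b') * d" unfolding eq by (simp add: mult.commute)
            then show "c = d" using K_cancel[of "b - b'" c d] cd True zK K_diff by auto
          qed
        qed
        moreover have "z \<in> Q" using True z unfolding Q_def by auto
        ultimately show ?thesis by simp
      next
        case F: False
        have "{c \<in> K - {0}. sol c z} = {}"
        proof -
          have "\<not> sol c z" if "c \<in> K" "c \<noteq> 0" for c
          proof
            assume "sol c z"
            then have *: "c * (b - b') = a' - a" by (simp add: eq)
            have "b = b'"
            proof (rule ccontr)
              assume "b \<noteq> b'"
              then have "a = a'" using F by blast
              then show False using * K_mult_nonzero[of c "b - b'"] that zK K_diff \<open>b \<noteq> b'\<close> by simp
            qed
            moreover have "a = a'" using * calculation by simp
            ultimately show False using False z(1) by simp
          qed
          then show ?thesis by blast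
        qed
        then have "card {c \<in> K - {0}. sol c z} = 0" by (simp only: card.empty)
        then show ?thesis by (simp only: le0)
      qed
    qed
  qed
  also have "\<dots> = card A * card B * n + card Q"
  proof -
    have "{z \<in> ?S. fst z = snd z} = (\<lambda>p. (p, p)) ` (A \<times> B)" by auto
    then have "card {z \<in> ?S. fst z = snd z} = card A * card B"
      by (simp add: card_image inj_on_def card_cartesian_product)
    moreover have "(\<Sum>z\<in>?S. if fst z = snd z then n else 0) = card {z \<in> ?S. fst z = snd z} * n"
      using finS by (simp add: sum.If_cases Int_def)
    moreover have "(\<Sum>z\<in>?S. if z \<in> Q then 1 else 0) = card Q"
    proof -
      have "{z. z \<in> ?S \<and> z \<in> Q} = Q" unfolding Q_def by auto
      then show ?thesis using finS by (simp add: sum.If_cases Int_def)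
    qed
    ultimately show ?thesis by (simp add: sum.distrib)
  qed
  also have "card Q = card A * (card A - 1) * (card B * (card B - 1))"
  proof -
    have pairs: "card {(a, a'). a \<in> S \<and> a' \<in> S \<and> a \<noteq> a'} = card S * (card S - 1)" if "finite S" for S :: "'a set"
    proof -
      have "{(a, a'). a \<in> S \<and> a' \<in> S \<and> a \<noteq> a'} = Sigma S (\<lambda>a. S - {a})" by auto
      then show ?thesis using that by (simp add: card_SigmaI)
    qed
    have "bij_betw (\<lambda>((a, a'), (b, b')). ((a, b), (a', b')))
      ({(a, a'). a \<in> A \<and> a' \<in> A \<and> a \<noteq> a'} \<times> {(b, b'). b \<in> B \<and> b' \<in> B \<and> b \<noteq> b'}) Q"
      by (rule bij_betw_byWitness[where f' = "\<lambda>((a, b), (a', b')). ((a, a'), (b, b'))"]) (auto simp: Q_def)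
    from bij_betw_same_card[OF this] show ?thesis
      using pairs fin by (simp add: card_cartesian_product)
  qed
  finally show ?thesis .
qed

definition reps_variance :: "'a set \<Rightarrow> 'a set \<Rightarrow> 'a \<Rightarrow> real" where
  "reps_variance A B c = (\<Sum>x\<in>K. (real (reps A B c x) - real (card A) * real (card B) / real (n + 1))\<^sup>2)"

lemma reps_variance_eq:
  assumes A: "A \<subseteq> K" and B: "B \<subseteq> K" and c: "c \<in> K"
  shows "reps_variance A B c = real (\<Sum>x\<in>K. (reps A B c x)^2) - (real (card A) * real (card B))\<^sup>2 / real (n + 1)"
proof -
  define \<mu> where "\<mu> = real (card A) * real (card B) / real (n + 1)"
  have s: "(\<Sum>x\<in>K. real (reps A B c x)) = real (card A) * real (card B)"
    using sum_reps[OF assms] by (simp flip: of_nat_sum of_nat_mult)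
  have "reps_variance A B c = (\<Sum>x\<in>K. (real (reps A B c x))\<^sup>2 - 2 * \<mu> * real (reps A B c x) + \<mu>\<^sup>2)"
    unfolding reps_variance_def \<mu>_def[symmetric] by (simp add: power2_diff algebra_simps)
  also have "\<dots> = (\<Sum>x\<in>K. (real (reps A B c x))\<^sup>2) - 2 * \<mu> * (real (card A) * real (card B)) + real (n + 1) * \<mu>\<^sup>2"
    by (simp add: sum.distrib sum_subtractf card_K s flip: sum_distrib_left)
  also have "real (n + 1) * \<mu>\<^sup>2 = \<mu> * (real (card A) * real (card B))"
  proof -
    have "real (n + 1) * \<mu>\<^sup>2 = \<mu> * (real (n + 1) * \<mu>)" by (simp add: power2_eq_square)
    also have "real (n + 1) * \<mu> = real (card A) * real (card B)" unfolding \<mu>_def by simp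
    finally show ?thesis .
  qed
  finally have "reps_variance A B c = (\<Sum>x\<in>K. (real (reps A B c x))\<^sup>2) - \<mu> * (real (card A) * real (card B))"
    by simp
  also have "\<mu> * (real (card A) * real (card B)) = (real (card A) * real (card B))\<^sup>2 / real (n + 1)"
    unfolding \<mu>_def by (simp add: power2_eq_square)
  finally show ?thesis by simp
qed

text \<open>Substitute d b for b. The undilated count is written with the field unit
  \<open>e\<close>, which need not be the ring unit 1.\<close>

lemma reps_dilate:
  assumes "d \<in> K" "d \<noteq> 0" "B \<subseteq> K" "(*) d ` B = B"
  shows "reps A B d x = reps A B e x"
proof -
  have "bij_betw (\<lambda>(a, b). (a, d * b)) {(a, b). a \<in> A \<and> b \<in> B \<and> a + d * b = x} {(a, b). a \<in> A \<and> b \<in> B \<and> a + e * b = x}"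
  proof (rule bij_betw_imageI)
    show "inj_on (\<lambda>(a, b). (a, d * b)) {(a, b). a \<in> A \<and> b \<in> B \<and> a + d * b = x}"
      using K_cancel[OF assms(1,2)] assms(3) by (auto simp: inj_on_def)
    have "\<And>b. b \<in> B \<Longrightarrow> e * b = b" using e_mult assms(3) by blast
    then show "(\<lambda>(a, b). (a, d * b)) ` {(a, b). a \<in> A \<and> b \<in> B \<and> a + d * b = x} = {(a, b). a \<in> A \<and> b \<in> B \<and> a + e * b = x}"
    proof (intro subset_antisym subsetI, goal_cases)
      case (1 z) then show ?case using assms(4) by fastforce
    next
      case (2 z)
      then obtain a b where ab: "z = (a, b)" "a \<in> A" "b \<in> B" "a + e * b = x" by auto
      then obtain b' where "b' \<in> B" "b = d * b'" using assms(4) by auto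
      then show ?case using ab 2(1) by (auto intro!: image_eqI[of _ _ "(a, b')"])
    qed
  qed
  then show ?thesis unfolding reps_def by (rule bij_betw_same_card)
qed

text \<open>The M elements of D have the same variance, so M times it is at most the sum of the
  variances over all nonzero c, where the energy is known on average.\<close>

lemma reps_variance_le:
  assumes A: "A \<subseteq> K" and B: "B \<subseteq> K" and M: "card A = M" "card B = M" "M > 0"
    and D: "D \<subseteq> K - {0}" "card D = M" "\<And>d. d \<in> D \<Longrightarrow> (*) d ` B = B"
  shows "reps_variance A B e \<le> real M * real (n + 1)"
proof -
  have "M \<le> n + 1" using A M finite_K card_mono card_K by metis
  have nonneg: "reps_variance A B c \<ge> 0" for c unfolding reps_variance_def by (simp add: sum_nonneg)
  have "real M * reps_variance A B e = (\<Sum>d\<in>D. reps_variance A B d)"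
  proof -
    have "reps_variance A B d = reps_variance A B e" if "d \<in> D" for d
    proof -
      have "reps A B d x = reps A B e x" for x using reps_dilate[OF _ _ B D(3)[OF that]] D(1) that by blast
      then show ?thesis unfolding reps_variance_def by simp
    qed
    then show ?thesis using D(2) by simp
  qed
  also have "\<dots> \<le> (\<Sum>c\<in>K-{0}. reps_variance A B c)"
    using D nonneg finite_K by (intro sum_mono2) auto
  also have "\<dots> = (\<Sum>c\<in>K-{0}. real (\<Sum>x\<in>K. (reps A B c x)^2)) - real n * ((real M * real M)\<^sup>2 / real (n + 1))"
    using reps_variance_eq[OF A B] M card_K zero_in_K finite_K by (simp add: sum_subtractf)
  also have "(\<Sum>c\<in>K-{0}. real (\<Sum>x\<in>K. (reps A B c x)^2)) \<le> real (M * M * n + M * (M - 1) * (M * (M - 1)))"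
    using sum_energy_le[OF A B] unfolding M of_nat_sum[symmetric] by (simp only: of_nat_le_iff)
  also have "real (M * M * n + M * (M - 1) * (M * (M - 1))) = (real M)\<^sup>2 * (real n + (real M - 1)\<^sup>2)"
  proof -
    have "real (M - 1) = real M - 1" using M(3) by simp
    then show ?thesis by (simp only: of_nat_add of_nat_mult) (simp add: power2_eq_square algebra_simps)
  qed
  also have "(real M)\<^sup>2 * (real n + (real M - 1)\<^sup>2) - real n * ((real M * real M)\<^sup>2 / real (n + 1))
      = (real M)\<^sup>2 * (real n + 1 - 2 * real M + (real M)\<^sup>2 / real (n + 1))"
    by (simp add: power2_eq_square field_simps)
  \<comment> \<open>Since M is at most n + 1, the term M^2 / (n + 1) is at most M and is absorbed by
    - 2 M.\<close>
  also have "\<dots> \<le> (real M)\<^sup>2 * (real n + 1)"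
  proof -
    have "(real M)\<^sup>2 / real (n + 1) \<le> real M"
      using \<open>M \<le> n + 1\<close> by (simp add: power2_eq_square divide_le_eq mult_left_mono del: of_nat_Suc of_nat_add)
    then show ?thesis by (intro mult_left_mono) auto
  qed
  finally have "real M * reps_variance A B e \<le> real M * (real M * real (n + 1))"
    by (simp add: power2_eq_square algebra_simps)
  then show ?thesis using M(3) by simp
qed

text \<open>Summing the representation counts of s - c over C gives the main term. By Cauchy-Schwarz
  the deviation is at most the square root of M times the variance, that is M sqrt(n + 1).\<close>

lemma three_sum_lower_bound:
  assumes A: "A \<subseteq> K" and B: "B \<subseteq> K" and C: "C \<subseteq> K" and s: "s \<in> K"
    and M: "card A = M" "card B = M" "card C = M" "M > 0"
    and D: "D \<subseteq> K - {0}" "card D = M" "\<And>d. d \<in> D \<Longrightarrow> (*) d ` B = B"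
  shows "real (card {(a, b, c). a \<in> A \<and> b \<in> B \<and> c \<in> C \<and> a + b + c = s}) \<ge>
    real M ^ 3 / real (n + 1) - real M * sqrt (real (n + 1))"
proof -
  define \<mu> where "\<mu> = (real M)\<^sup>2 / real (n + 1)"
  have finC: "finite C" using C finite_K finite_subset by blast
  have "card {(a, b, c). a \<in> A \<and> b \<in> B \<and> c \<in> C \<and> a + b + c = s} = (\<Sum>c\<in>C. reps A B e (s - c))"
  proof -
    have "bij_betw (\<lambda>(c, (a, b)). (a, b, c)) (Sigma C (\<lambda>c. {(a, b). a \<in> A \<and> b \<in> B \<and> a + e * b = s - c}))
      {(a, b, c). a \<in> A \<and> b \<in> B \<and> c \<in> C \<and> a + b + c = s}"
      by (rule bij_betw_byWitness[where f' = "\<lambda>(a, b, c). (c, (a, b))"])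
        (use B e_mult in \<open>auto simp: algebra_simps subset_iff\<close>)
    from bij_betw_same_card[OF this] show ?thesis
      unfolding reps_def using finC finite_reps[OF A B] by (simp add: card_SigmaI)
  qed
  moreover have "real (\<Sum>c\<in>C. reps A B e (s - c)) \<ge> real M * \<mu> - real M * sqrt (real (n + 1))"
  proof -
    \<comment> \<open>Cauchy-Schwarz is applied as a weighted inequality of the two means; this
      weight balances its two terms, as the variance bound averages to n + 1 per element of
      C.\<close>
    define \<rho> where "\<rho> = sqrt (real (n + 1))"
    have \<rho>: "\<rho> > 0" "\<rho> * \<rho> = real (n + 1)" unfolding \<rho>_def by auto
    have amgm: "y \<le> y\<^sup>2 / (2 * \<rho>) + \<rho> / 2" for y
    proof -
      have "2 * \<rho> * y \<le> y\<^sup>2 + \<rho>\<^sup>2" using sum_squares_bound[of y \<rho>] by (simp add: algebra_simps)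
      then show ?thesis using \<rho>(1) by (simp add: field_simps power2_eq_square)
    qed
    have "(\<Sum>c\<in>C. (\<mu> - real (reps A B e (s - c)))\<^sup>2) = (\<Sum>x\<in>(\<lambda>c. s - c) ` C. (\<mu> - real (reps A B e x))\<^sup>2)"
      by (subst sum.reindex) (auto simp: inj_on_def)
    also have "\<dots> \<le> (\<Sum>x\<in>K. (\<mu> - real (reps A B e x))\<^sup>2)"
      using C s K_diff finite_K by (intro sum_mono2) auto
    also have "\<dots> = reps_variance A B e"
      unfolding reps_variance_def \<mu>_def M power2_eq_square[of "real M"]
      by (rule sum.cong[OF refl]) (rule power2_commute)
    also have "\<dots> \<le> real M * real (n + 1)" by (rule reps_variance_le[OF A B M(1,2,4) D])
    finally have sq: "(\<Sum>c\<in>C. (\<mu> - real (reps A B e (s - c)))\<^sup>2) \<le> real M * (\<rho> * \<rho>)" unfolding \<rho> .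
    have "(\<Sum>c\<in>C. \<mu> - real (reps A B e (s - c))) \<le> (\<Sum>c\<in>C. (\<mu> - real (reps A B e (s - c)))\<^sup>2 / (2 * \<rho>) + \<rho> / 2)"
      by (rule sum_mono) (rule amgm)
    also have "\<dots> = (\<Sum>c\<in>C. (\<mu> - real (reps A B e (s - c)))\<^sup>2) / (2 * \<rho>) + real M * (\<rho> / 2)"
      by (simp add: sum.distrib sum_divide_distrib M)
    also have "\<dots> \<le> real M * (\<rho> * \<rho>) / (2 * \<rho>) + real M * (\<rho> / 2)"
      using \<rho>(1) by (intro add_right_mono divide_right_mono sq) simp
    also have "\<dots> = real M * \<rho>" using \<rho>(1) by (simp add: field_simps)
    finally show ?thesis unfolding \<rho>_def by (simp add: sum_subtractf M)
  qed
  ultimately show ?thesis unfolding \<mu>_def by (simp add: power2_eq_square power3_eq_cube)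
qed

end

section \<open>Zero-sum sequences and conflicts\<close>

text \<open>Forgetting the coordinates a and b is injective on Y. Here one equation besides the zero
  sum costs a second factor M.\<close>

lemma card_PiE_determined_le:
  assumes I: "finite I" "a \<in> I" "b \<in> I" "a \<noteq> b"
    and C: "\<And>i. i \<in> I \<Longrightarrow> finite (C i) \<and> card (C i) = M"
    and Y: "Y \<subseteq> PiE I C"
    and det: "\<And>y z. y \<in> Y \<Longrightarrow> z \<in> Y \<Longrightarrow> (\<And>i. i \<in> I - {a, b} \<Longrightarrow> y i = z i) \<Longrightarrow> y a = z a \<and> y b = z b"
  shows "card Y \<le> M ^ (card I - 2)"
proof -
  let ?J = "I - {a, b}"
  have "inj_on (\<lambda>y. restrict y ?J) Y"
  proof (rule inj_onI)
    fix y z assume yz: "y \<in> Y" "z \<in> Y" and eq: "restrict y ?J = restrict z ?J"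
    have ag: "y i = z i" if "i \<in> ?J" for i using eq that by (metis restrict_apply')
    then have "y a = z a \<and> y b = z b" using det yz by blast
    then have "y i = z i" if "i \<in> I" for i using ag that by blast
    then show "y = z" using yz Y by (meson PiE_ext subsetD)
  qed
  moreover have "(\<lambda>y. restrict y ?J) ` Y \<subseteq> PiE ?J C"
  proof (rule image_subsetI)
    fix y assume "y \<in> Y"
    then have "y \<in> PiE I C" using Y by blast
    then show "restrict y ?J \<in> PiE ?J C" by (auto simp: PiE_iff)
  qed
  moreover have "finite (PiE ?J C)" using I C by (intro finite_PiE) auto
  ultimately have "card Y \<le> card (PiE ?J C)" by (rule card_inj_on_le)
  also have "\<dots> = (\<Prod>i\<in>?J. card (C i))" using I by (simp add: card_PiE)
  also have "\<dots> = M ^ card ?J" using C by simp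
  also have "card ?J = card I - 2" using I by (simp add: card_Diff_subset)
  finally show ?thesis .
qed

section \<open>Cosets of the subgroup of index k, and the scalars\<close>

locale coset_setup = odd_embedded_gf +
  fixes k w :: nat
  assumes m_eq: "m = k * w" and k3: "k \<ge> 3"
begin

lemma n_kw: "n = 2 * (k * w)" using n_eq m_eq by simp

lemma w_pos: "w > 0" using m_pos m_eq by simp

definition coset :: "nat \<Rightarrow> 'a set" where
  "coset i = {e * g ^ j | j. j mod k = i mod k}"

lemma pow_in_coset_iff: "e * g ^ j \<in> coset i \<longleftrightarrow> j mod k = i mod k"
proof
  assume "e * g ^ j \<in> coset i"
  then obtain j' where j': "e * g ^ j = e * g ^ j'" "j' mod k = i mod k" unfolding coset_def by blast
  then have "j mod n = j' mod n" by (simp add: pow_eq_iff)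
  moreover have "k dvd n" by (simp add: n_kw)
  ultimately have "j mod k = j' mod k" by (metis mod_mod_cancel)
  then show "j mod k = i mod k" using j' by simp
qed (auto simp: coset_def)

lemma coset_subset: "coset i \<subseteq> K - {0}"
  unfolding coset_def using pow_in_K pow_nonzero by auto

lemma finite_coset: "finite (coset i)" using coset_subset finite_K by (meson finite_Diff finite_subset)

lemma card_coset: "card (coset i) = 2 * w"
proof -
  have "bij_betw (\<lambda>a. e * g ^ (i + k * a)) {..<2 * w} (coset i)"
  proof (rule bij_betw_imageI)
    show "inj_on (\<lambda>a. e * g ^ (i + k * a)) {..<2 * w}"
    proof (rule inj_onI)
      fix a b assume ab: "a \<in> {..<2 * w}" "b \<in> {..<2 * w}" and "e * g ^ (i + k * a) = e * g ^ (i + k * b)"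
      then have "[i + k * a = i + k * b] (mod n)" by (simp add: pow_eq_iff cong_def)
      then have "[k * a = k * b] (mod n)" by (simp add: cong_add_lcancel_nat)
      moreover have "k * a < n" "k * b < n" using ab k3 by (auto simp: n_kw)
      ultimately have "k * a = k * b" by (simp add: cong_def)
      then show "a = b" using k3 by simp
    qed
    show "(\<lambda>a. e * g ^ (i + k * a)) ` {..<2 * w} = coset i"
    proof (intro subset_antisym subsetI)
      fix x assume "x \<in> (\<lambda>a. e * g ^ (i + k * a)) ` {..<2 * w}"
      then show "x \<in> coset i" using pow_in_coset_iff by auto
    next
      fix x assume "x \<in> coset i"
      then obtain j where j: "x = e * g ^ j" "j mod k = i mod k" unfolding coset_def by blast
      \<comment> \<open>Adding n i leaves the power of g unchanged and keeps the subtraction of i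
        exact on natural numbers.\<close>
      define b where "b = (j + n * i - i) div k"
      have "i \<le> n * i" using n_pos by simp
      then have "(j + n * i - i) mod k = 0"
      proof -
        have "j + n * i - i + i = j + n * i" using \<open>i \<le> n * i\<close> by linarith
        also have "\<dots> = j + k * (2 * w * i)" by (simp add: n_kw)
        finally have "(j + n * i - i + i) mod k = (0 + i) mod k" using j(2) by (simp only: mod_mult_self2 add_0)
        then have "[j + n * i - i = 0] (mod k)" unfolding cong_def[symmetric] by (simp only: cong_add_rcancel_nat)
        then show ?thesis by (simp add: cong_def)
      qed
      then have "k * b = j + n * i - i" unfolding b_def by auto
      then have "i + k * b = j + n * i" using \<open>i \<le> n * i\<close> by linarith
      moreover have "k * b mod n = k * (b mod (2 * w))" unfolding n_kw
        by (metis mult.left_commute mult_mod_right)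
      ultimately have "(i + k * (b mod (2 * w))) mod n = j mod n" by (metis mod_add_right_eq mod_mult_self2)
      then have "x = e * g ^ (i + k * (b mod (2 * w)))" unfolding j(1) by (simp add: pow_eq_iff)
      moreover have "b mod (2 * w) < 2 * w" using w_pos by simp
      ultimately show "x \<in> (\<lambda>a. e * g ^ (i + k * a)) ` {..<2 * w}" by blast
    qed
  qed
  from bij_betw_same_card[OF this] show ?thesis by simp
qed

lemma coset_dilate: assumes "d \<in> coset 0" shows "(*) d ` coset i = coset i"
proof -
  have "(*) d ` coset i \<subseteq> coset i"
  proof
    fix x assume "x \<in> (*) d ` coset i"
    then obtain a b where "d = e * g ^ a" "a mod k = 0" "x = d * (e * g ^ b)" "b mod k = i mod k"
      using assms unfolding coset_def by auto
    then show "x \<in> coset i" using pow_mult pow_in_coset_iff by (metis add_0 mod_add_left_eq)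
  qed
  moreover have "inj_on ((*) d) (coset i)"
    using K_cancel[of d] coset_subset assms by (intro inj_onI) blast
  ultimately show ?thesis using finite_coset endo_inj_surj by blast
qed

text \<open>The scalars T represent the subgroup of index k modulo the sign.\<close>
definition scalars :: "'a set" where
  "scalars = (\<lambda>a. e * g ^ (k * a)) ` {..<w}"

lemma scalars_subset: "scalars \<subseteq> K - {0}"
  unfolding scalars_def using pow_in_K pow_nonzero by auto

lemma pm_pow_mult_k: "a < w \<Longrightarrow> b < w \<Longrightarrow> (k * a) mod m = (k * b) mod m \<Longrightarrow> a = b"
  using k3 by (simp add: m_eq)

lemma card_scalars: "card scalars = w"
proof -
  have "inj_on (\<lambda>a. e * g ^ (k * a)) {..<w}"
    using pow_eq_pm_iff pm_pow_mult_k by (intro inj_onI) (metis lessThan_iff)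
  then show ?thesis unfolding scalars_def by (simp add: card_image)
qed

text \<open>Since k divides m, exponents modulo k survive a change of sign and show i = j. Then y =
  z cancels, and scalars equal up to sign are equal.\<close>

lemma scalars_differences:
  assumes "t \<in> scalars" "t' \<in> scalars" "y \<in> coset i" "z \<in> coset j" "i < k" "j < k" "i = j \<Longrightarrow> y = z"
    and "t * y = t' * z \<or> t * y = - (t' * z)"
  shows "t = t' \<and> i = j"
proof -
  obtain a b where ab: "a < w" "b < w" "t = e * g ^ (k * a)" "t' = e * g ^ (k * b)"
    using assms(1,2) unfolding scalars_def by auto
  obtain r s where rs: "y = e * g ^ r" "z = e * g ^ s" "r mod k = i" "s mod k = j"
    using assms(3-6) unfolding coset_def by auto
  have "(k * a + r) mod m = (k * b + s) mod m"
    using assms(8) unfolding ab rs pow_mult pow_eq_pm_iff .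
  then have "(k * a + r) mod k = (k * b + s) mod k" using m_eq by (metis dvd_triv_left mod_mod_cancel)
  then have ij: "i = j" using rs by simp
  then have "y = z" using assms(7) by simp
  then have "y * t = y * t' \<or> y * t = y * (- t')" using assms(8) by (simp add: mult.commute)
  moreover have "y \<in> K" "y \<noteq> 0" "t \<in> K" "t' \<in> K" using coset_subset scalars_subset assms by auto
  ultimately have "t = t' \<or> t = - t'" using K_cancel[of y t] K_uminus by blast
  then have "a = b" using ab pow_eq_pm_iff pm_pow_mult_k by metis
  then show ?thesis using ab ij by simp
qed

section \<open>Zero-sum sequences and vanishing blocks\<close>

definition zero_sums :: "(nat \<Rightarrow> 'a) set" where
  "zero_sums = {y \<in> PiE {..<k} coset. sum y {..<k} = 0}"

lemma zero_sums_in_K: "y \<in> zero_sums \<Longrightarrow> i < k \<Longrightarrow> y i \<in> K \<and> y i \<noteq> 0"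
  unfolding zero_sums_def PiE_def Pi_def using coset_subset by blast

lemma finite_zero_sums: "finite zero_sums"
  unfolding zero_sums_def using finite_coset by (auto intro!: finite_subset[OF _ finite_PiE[of "{..<k}" coset]])

lemma zero_sums_last:
  assumes "y \<in> zero_sums" "z \<in> zero_sums" "h < k" "\<And>i. i < k \<Longrightarrow> i \<noteq> h \<Longrightarrow> y i = z i"
  shows "y h = z h"
proof -
  have "sum y {..<k} = y h + sum y ({..<k} - {h})" "sum z {..<k} = z h + sum z ({..<k} - {h})"
    using assms(3) by (simp_all add: sum.remove)
  moreover have "sum y ({..<k} - {h}) = sum z ({..<k} - {h})" using assms(4) by (intro sum.cong) auto
  ultimately have "y h + sum z ({..<k} - {h}) = z h + sum z ({..<k} - {h})"
    using assms(1,2) unfolding zero_sums_def by simp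
  then show ?thesis by simp
qed

text \<open>The vanishing block determines y_i. As j < k, the index k - 1 lies outside the block,
  and the total sum then determines the last term.\<close>

lemma card_zero_sums_partial_le:
  assumes "i < j" "j < k"
  shows "card {y \<in> zero_sums. sum y {i..<j} = 0} \<le> (2 * w) ^ (k - 2)"
proof -
  have "card {y \<in> zero_sums. sum y {i..<j} = 0} \<le> (2 * w) ^ (card {..<k} - 2)"
  proof (rule card_PiE_determined_le[where a = i and b = "k - 1" and C = coset])
    fix y z assume y: "y \<in> {y \<in> zero_sums. sum y {i..<j} = 0}" and z: "z \<in> {y \<in> zero_sums. sum y {i..<j} = 0}"
      and ag: "\<And>l. l \<in> {..<k} - {i, k - 1} \<Longrightarrow> y l = z l"
    have "sum y {i..<j} = y i + sum y ({i..<j} - {i})" "sum z {i..<j} = z i + sum z ({i..<j} - {i})"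
      using assms by (simp_all add: sum.remove)
    moreover have "sum y ({i..<j} - {i}) = sum z ({i..<j} - {i})" using ag assms by (intro sum.cong) auto
    ultimately have "y i + sum z ({i..<j} - {i}) = z i + sum z ({i..<j} - {i})" using y z by simp
    then have "y i = z i" by simp
    moreover have "y (k - 1) = z (k - 1)"
      by (rule zero_sums_last) (use y z assms ag \<open>y i = z i\<close> in auto)
    ultimately show "y i = z i \<and> y (k - 1) = z (k - 1)" ..
  qed (use assms finite_coset card_coset in \<open>auto simp: zero_sums_def\<close>)
  then show ?thesis by simp
qed

text \<open>A block ending with the last term is covered through its complement, an initial block.
  The condition says that the k partial sums are distinct.\<close>

definition proper_zero_sums :: "(nat \<Rightarrow> 'a) set" where
  "proper_zero_sums = {y \<in> zero_sums. \<forall>i j. i < j \<longrightarrow> j < k \<longrightarrow> sum y {i..<j} \<noteq> 0}"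

lemma card_zero_sums_le: "card zero_sums \<le> card proper_zero_sums + k ^ 2 * (2 * w) ^ (k - 2)"
proof -
  define P where "P = {(i, j). i < j \<and> j < k}"
  have P: "P \<subseteq> {..<k} \<times> {..<k}" unfolding P_def by auto
  have finP: "finite P" using P by (rule finite_subset) simp
  have cardP: "card P \<le> k ^ 2" using card_mono[OF _ P] by (simp add: card_cartesian_product power2_eq_square)
  let ?B = "\<lambda>(i, j). {y \<in> zero_sums. sum y {i..<j} = 0}"
  have "zero_sums \<subseteq> proper_zero_sums \<union> (\<Union>p\<in>P. ?B p)" unfolding proper_zero_sums_def P_def by auto
  moreover have finG: "finite proper_zero_sums" unfolding proper_zero_sums_def using finite_zero_sums by simp
  moreover have "finite (\<Union>p\<in>P. ?B p)" using finP finite_zero_sums by auto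
  ultimately have "card zero_sums \<le> card (proper_zero_sums \<union> (\<Union>p\<in>P. ?B p))" by (intro card_mono) auto
  also have "\<dots> \<le> card proper_zero_sums + card (\<Union>p\<in>P. ?B p)" by (rule card_Un_le)
  also have "card (\<Union>p\<in>P. ?B p) \<le> (\<Sum>p\<in>P. card (?B p))" using finP by (rule card_UN_le)
  also have "\<dots> \<le> (\<Sum>p\<in>P. (2 * w) ^ (k - 2))"
    by (rule sum_mono) (use card_zero_sums_partial_le in \<open>auto simp: P_def simp del: power_mult_distrib\<close>)
  also have "\<dots> = card P * (2 * w) ^ (k - 2)" by simp
  also have "\<dots> \<le> k ^ 2 * (2 * w) ^ (k - 2)" using cardP by (rule mult_right_mono) simp
  finally show ?thesis by simp
qed

section \<open>Conflicts between sequences\<close>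

definition conflict :: "(nat \<Rightarrow> 'a) \<Rightarrow> (nat \<Rightarrow> 'a) \<Rightarrow> bool" where
  "conflict y z \<longleftrightarrow> (\<exists>i j a b. i < k \<and> j < k \<and> a < k \<and> b < k \<and> i \<noteq> j \<and> a \<noteq> b \<and>
     (y i * z b = y j * z a \<or> y i * z b = - (y j * z a)))"

text \<open>The choice (i, j) = (a, b) is a conflict by commutativity. Hence the members of a
  maximal conflict-free set are themselves covered in \<open>ex_conflict_free\<close>.\<close>

lemma conflict_self: "conflict y y"
  unfolding conflict_def using k3
  by (intro exI[of _ 0] exI[of _ 1]) (auto simp: mult.commute intro!: exI[of _ "0::nat"] exI[of _ "1::nat"])

lemma conflict_sym: "conflict y z \<Longrightarrow> conflict z y"
  unfolding conflict_def
proof (elim exE conjE)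
  fix i j a b assume *: "i < k" "j < k" "a < k" "b < k" "i \<noteq> j" "a \<noteq> b"
    "y i * z b = y j * z a \<or> y i * z b = - (y j * z a)"
  have "z b * y i = z a * y j \<or> z b * y i = - (z a * y j)" using *(7) by (simp add: mult.commute)
  then show "\<exists>i j a b. i < k \<and> j < k \<and> a < k \<and> b < k \<and> i \<noteq> j \<and> a \<noteq> b \<and>
     (z i * y b = z j * y a \<or> z i * y b = - (z j * y a))" using * by metis
qed

text \<open>The ratio determines y_i from y_j, and the zero sum determines a term at a third index
  h, which exists because k is at least 3.\<close>

lemma card_ratio_le:
  assumes ij: "i < k" "j < k" "i \<noteq> j" and c: "c \<in> K" "c \<noteq> 0"
  shows "card {y \<in> zero_sums. y i * c = y j * d} \<le> (2 * w) ^ (k - 2)"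
proof -
  obtain h where h: "h < k" "h \<noteq> i" "h \<noteq> j"
  proof -
    have "card {i, j} < card {..<k}" using k3 ij by simp
    then have "\<not> {..<k} \<subseteq> {i, j}" by (meson card_mono finite.emptyI finite.insertI leD)
    then show ?thesis using that by blast
  qed
  have "card {y \<in> zero_sums. y i * c = y j * d} \<le> (2 * w) ^ (card {..<k} - 2)"
  proof (rule card_PiE_determined_le[where a = i and b = h and C = coset])
    fix y z assume y: "y \<in> {y \<in> zero_sums. y i * c = y j * d}" and z: "z \<in> {y \<in> zero_sums. y i * c = y j * d}"
      and ag: "\<And>l. l \<in> {..<k} - {i, h} \<Longrightarrow> y l = z l"
    have "y j = z j" using ag ij h by auto
    then have "c * y i = c * z i" using y z by (simp add: mult.commute)
    then have "y i = z i" using K_cancel[OF c] zero_sums_in_K y z ij by blast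
    moreover have "y h = z h"
      by (rule zero_sums_last) (use y z ag h \<open>y i = z i\<close> in auto)
    ultimately show "y i = z i \<and> y h = z h" ..
  qed (use ij h finite_coset card_coset in \<open>auto simp: zero_sums_def\<close>)
  then show ?thesis by simp
qed

text \<open>Comparing cosets of the subgroup of index k, the index b of a conflict is determined by i, j and a.\<close>
lemma card_conflict_le:
  assumes z: "z \<in> zero_sums"
  shows "card {y \<in> zero_sums. conflict y z} \<le> 2 * k ^ 3 * (2 * w) ^ (k - 2)"
proof -
  \<comment> \<open>This is j + a - i modulo k, with k - i in place of - i on natural
    numbers.\<close>
  define \<beta> where "\<beta> i j a = (j + a + (k - i)) mod k" for i j a
  \<comment> \<open>The flag s is the sign: k^3 triples and two signs produce the factor 2
    k^3.\<close>
  define S where "S = (\<lambda>(i, j, a, s). if i = j then {} else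
     {y \<in> zero_sums. y i * z (\<beta> i j a) = y j * (if s then z a else - z a)})"
  define J where "J = {..<k} \<times> {..<k} \<times> {..<k} \<times> (UNIV :: bool set)"
  have finJ: "finite J" and cardJ: "card J = 2 * k ^ 3"
    unfolding J_def by (simp_all add: card_cartesian_product power3_eq_cube card_UNIV_bool)
  have "{y \<in> zero_sums. conflict y z} \<subseteq> (\<Union>p\<in>J. S p)"
  proof
    fix y assume "y \<in> {y \<in> zero_sums. conflict y z}"
    then obtain i j a b where y: "y \<in> zero_sums" and lt: "i < k" "j < k" "a < k" "b < k" and ne: "i \<noteq> j"
      and eq: "y i * z b = y j * z a \<or> y i * z b = - (y j * z a)" unfolding conflict_def by blast
    have mem: "y i \<in> coset i" "y j \<in> coset j" "z a \<in> coset a" "z b \<in> coset b"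
      using y z lt unfolding zero_sums_def PiE_def Pi_def by auto
    then obtain r s t u where *: "y i = e * g ^ r" "r mod k = i" "y j = e * g ^ s" "s mod k = j"
      "z a = e * g ^ t" "t mod k = a" "z b = e * g ^ u" "u mod k = b"
      using lt unfolding coset_def by auto
    have "(r + u) mod m = (s + t) mod m" using eq unfolding * pow_mult pow_eq_pm_iff .
    then have "(r + u) mod k = (s + t) mod k" using m_eq by (metis dvd_triv_left mod_mod_cancel)
    then have ib: "(i + b) mod k = (j + a) mod k" using * by (metis mod_add_eq)
    have "\<beta> i j a = ((j + a) mod k + (k - i)) mod k" unfolding \<beta>_def by (simp add: mod_simps)
    also have "\<dots> = (i + b + (k - i)) mod k" unfolding ib[symmetric] by (simp add: mod_simps)
    also have "\<dots> = b" using lt by simp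
    finally have "\<beta> i j a = b" .
    then have "y \<in> S (i, j, a, True) \<or> y \<in> S (i, j, a, False)" unfolding S_def using y ne eq by auto
    moreover have "(i, j, a, True) \<in> J" "(i, j, a, False) \<in> J" unfolding J_def using lt by auto
    ultimately show "y \<in> (\<Union>p\<in>J. S p)" by blast
  qed
  moreover have "finite (\<Union>p\<in>J. S p)" using finJ finite_zero_sums unfolding S_def by auto
  ultimately have "card {y \<in> zero_sums. conflict y z} \<le> card (\<Union>p\<in>J. S p)" by (intro card_mono)
  also have "\<dots> \<le> (\<Sum>p\<in>J. card (S p))" using finJ by (rule card_UN_le)
  also have "\<dots> \<le> (\<Sum>p\<in>J. (2 * w) ^ (k - 2))"
  proof (rule sum_mono)
    fix p assume "p \<in> J"
    then obtain i j a s where p: "p = (i, j, a, s)" "i < k" "j < k" "a < k" unfolding J_def by auto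
    have "\<beta> i j a < k" unfolding \<beta>_def using k3 by simp
    then show "card (S p) \<le> (2 * w) ^ (k - 2)"
      using card_ratio_le[of i j "z (\<beta> i j a)"] zero_sums_in_K[OF z] p unfolding S_def by simp
  qed
  also have "\<dots> = 2 * k ^ 3 * (2 * w) ^ (k - 2)" by (simp add: cardJ)
  finally show ?thesis .
qed

text \<open>By maximality every proper sequence conflicts with some member of F, so the conflict
  sets of the members cover all proper sequences.\<close>

lemma ex_conflict_free:
  "\<exists>F \<subseteq> proper_zero_sums. (\<forall>y\<in>F. \<forall>z\<in>F. y \<noteq> z \<longrightarrow> \<not> conflict y z) \<and>
     card proper_zero_sums \<le> card F * (2 * k ^ 3 * (2 * w) ^ (k - 2))"
proof -
  have fin: "finite proper_zero_sums" unfolding proper_zero_sums_def using finite_zero_sums by simp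
  define \<F> where "\<F> = {F. F \<subseteq> proper_zero_sums \<and> (\<forall>y\<in>F. \<forall>z\<in>F. y \<noteq> z \<longrightarrow> \<not> conflict y z)}"
  have "finite \<F>" unfolding \<F>_def using fin by simp
  moreover have "{} \<in> \<F>" unfolding \<F>_def by simp
  ultimately obtain F where F: "F \<in> \<F>" "\<And>F'. F' \<in> \<F> \<Longrightarrow> F \<subseteq> F' \<Longrightarrow> F = F'"
    using finite_has_maximal[of \<F>] by blast
  then have Fsub: "F \<subseteq> proper_zero_sums" and free: "\<forall>y\<in>F. \<forall>z\<in>F. y \<noteq> z \<longrightarrow> \<not> conflict y z"
    unfolding \<F>_def by auto
  have finF: "finite F" using Fsub fin finite_subset by blast
  have "proper_zero_sums \<subseteq> (\<Union>z\<in>F. {y \<in> zero_sums. conflict y z})"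
  proof
    fix y assume y: "y \<in> proper_zero_sums"
    then have y': "y \<in> zero_sums" unfolding proper_zero_sums_def by simp
    show "y \<in> (\<Union>z\<in>F. {y \<in> zero_sums. conflict y z})"
    proof (rule ccontr)
      assume n: "\<not> ?thesis"
      then have nc: "\<not> conflict y z" if "z \<in> F" for z using that y' by blast
      then have "insert y F \<in> \<F>" unfolding \<F>_def using Fsub free y nc by (auto dest: conflict_sym)
      then have "y \<in> F" using F(2) by blast
      then show False using nc conflict_self by blast
    qed
  qed
  moreover have "finite (\<Union>z\<in>F. {y \<in> zero_sums. conflict y z})" using finF finite_zero_sums by simp
  ultimately have "card proper_zero_sums \<le> card (\<Union>z\<in>F. {y \<in> zero_sums. conflict y z})" by (intro card_mono)
  also have "\<dots> \<le> (\<Sum>z\<in>F. card {y \<in> zero_sums. conflict y z})" using finF by (rule card_UN_le)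
  also have "\<dots> \<le> (\<Sum>z\<in>F. 2 * k ^ 3 * (2 * w) ^ (k - 2))"
    using Fsub by (intro sum_mono card_conflict_le) (auto simp: proper_zero_sums_def)
  finally show ?thesis using Fsub free by auto
qed

end

section \<open>Existence of many orthogonal systems\<close>

context coset_setup
begin

text \<open>With M > 8 k^4 the main term is at least 3 M^2 / (4 k) and the error at most M^2 / (4
  k).\<close>

lemma three_cosets_ge:
  assumes w: "w > 4 * k ^ 4" and s: "s \<in> K"
  shows "real (card {(a, b, c). a \<in> coset 0 \<and> b \<in> coset 1 \<and> c \<in> coset 2 \<and> a + b + c = s})
    \<ge> (real (2 * w))\<^sup>2 / (2 * real k)"
proof -
  define M where "M = real (2 * w)"
  define \<kappa> where "\<kappa> = real k"
  have \<kappa>: "\<kappa> \<ge> 3" using k3 unfolding \<kappa>_def by simp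
  have "M > 8 * \<kappa> ^ 4"
  proof -
    have "real w > real (4 * k ^ 4)" using w by (simp only: of_nat_less_iff)
    then show ?thesis unfolding M_def \<kappa>_def by simp
  qed
  moreover have "\<kappa> ^ 4 \<ge> 3 * \<kappa> ^ 3" using \<kappa> by (simp add: power4_eq_xxxx power3_eq_cube mult_right_mono)
  ultimately have M3: "M \<ge> 24 * \<kappa> ^ 3" by linarith
  have "\<kappa> ^ 3 \<ge> 1" using \<kappa> by simp
  then have M24: "M \<ge> 24" using M3 by linarith
  have n: "real (n + 1) = \<kappa> * M + 1" unfolding \<kappa>_def M_def n_kw by simp
  have \<kappa>M: "\<kappa> * M \<ge> 3" using mult_mono[of 3 \<kappa> 1 M] \<kappa> M24 by simp
  have 1: "M ^ 3 / real (n + 1) \<ge> 3 * M\<^sup>2 / (4 * \<kappa>)"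
  proof -
    have "3 * M\<^sup>2 * (\<kappa> * M + 1) = M\<^sup>2 * (3 * (\<kappa> * M) + 3)" by (simp add: algebra_simps)
    also have "\<dots> \<le> M\<^sup>2 * (4 * (\<kappa> * M))"
    proof (rule mult_left_mono)
      show "3 * (\<kappa> * M) + 3 \<le> 4 * (\<kappa> * M)" using \<kappa>M by linarith
    qed simp
    also have "\<dots> = M ^ 3 * (4 * \<kappa>)" by (simp add: power2_eq_square power3_eq_cube)
    finally show ?thesis unfolding n using \<kappa> \<kappa>M by (simp add: divide_simps mult.commute[of M \<kappa>])
  qed
  \<comment> \<open>Squared, this asks for 16 k^2 (k M + 1) to be at most M^2; M \<ge> 24 k^3 leaves
    room over the required 64/3 k^3.\<close>
  have "sqrt (real (n + 1)) \<le> M / (4 * \<kappa>)"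
  proof (rule real_le_lsqrt)
    have "16 * \<kappa>\<^sup>2 * (\<kappa> * M + 1) \<le> 16 * \<kappa>\<^sup>2 * (4 / 3 * (\<kappa> * M))"
    proof (rule mult_left_mono)
      show "\<kappa> * M + 1 \<le> 4 / 3 * (\<kappa> * M)" using \<kappa>M by linarith
    qed simp
    also have "\<dots> = 64 / 3 * \<kappa> ^ 3 * M" by (simp add: power2_eq_square power3_eq_cube)
    also have "\<dots> \<le> M * M" using M3 M24 \<open>\<kappa> ^ 3 \<ge> 1\<close> by (intro mult_right_mono) auto
    finally have "16 * \<kappa>\<^sup>2 * (\<kappa> * M + 1) \<le> M * M" .
    then show "real (n + 1) \<le> (M / (4 * \<kappa>))\<^sup>2"
      unfolding n using \<kappa> by (simp add: power2_eq_square field_simps)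
  qed (use M24 \<kappa> in auto)
  then have "M * sqrt (real (n + 1)) \<le> M * (M / (4 * \<kappa>))" using M24 by (intro mult_left_mono) auto
  then have 2: "M * sqrt (real (n + 1)) \<le> M\<^sup>2 / (4 * \<kappa>)" by (simp add: power2_eq_square)
  have 3: "3 * M\<^sup>2 / (4 * \<kappa>) - M\<^sup>2 / (4 * \<kappa>) = M\<^sup>2 / (2 * \<kappa>)" by (simp add: field_simps)
  have "real (card {(a, b, c). a \<in> coset 0 \<and> b \<in> coset 1 \<and> c \<in> coset 2 \<and> a + b + c = s})
    \<ge> real (2 * w) ^ 3 / real (n + 1) - real (2 * w) * sqrt (real (n + 1))"
    by (rule three_sum_lower_bound[where D = "coset 0"])
      (use coset_subset card_coset coset_dilate w_pos s in auto)
  then show ?thesis using 1 2 3 unfolding M_def \<kappa>_def by linarith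
qed

text \<open>The terms from index 3 on are free, in M^(k-3) ways; the first three must then represent
  minus their sum.\<close>

lemma card_zero_sums_ge:
  assumes w: "w > 4 * k ^ 4"
  shows "real (card zero_sums) \<ge> real (2 * w) ^ (k - 3) * ((real (2 * w))\<^sup>2 / (2 * real k))"
proof -
  define Z where "Z = PiE {3..<k} coset"
  define trip where "trip z = {(a, b, c). a \<in> coset 0 \<and> b \<in> coset 1 \<and> c \<in> coset 2 \<and> a + b + c = - sum z {3..<k}}" for z
  define f where "f = (\<lambda>(z :: nat \<Rightarrow> 'a, a, b, c) (i :: nat). if i = 0 then a else if i = 1 then b else if i = 2 then c else z i :: 'a)"
  have finZ: "finite Z" unfolding Z_def using finite_coset by (intro finite_PiE) auto
  have cardZ: "card Z = (2 * w) ^ (k - 3)" unfolding Z_def by (simp add: card_PiE card_coset)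
  have fint: "finite (trip z)" for z
    by (rule finite_subset[of _ "coset 0 \<times> coset 1 \<times> coset 2"]) (auto simp: trip_def finite_coset)
  have split: "{..<k} = insert 0 (insert 1 (insert 2 {3..<k}))" using k3 by auto
  have "inj_on f (Sigma Z trip)"
  proof (rule inj_onI, clarify)
    fix z a b c z' a' b' c'
    assume z: "z \<in> Z" "z' \<in> Z" and eq: "f (z, a, b, c) = f (z', a', b', c')"
    have eqi: "f (z, a, b, c) i = f (z', a', b', c') i" for i using eq by simp
    have "a = a'" "b = b'" "c = c'" using eqi[of 0] eqi[of 1] eqi[of 2] by (simp_all add: f_def)
    moreover have "z i = z' i" if "i \<in> {3..<k}" for i using eqi[of i] that by (simp add: f_def)
    then have "z = z'" using z unfolding Z_def by (intro PiE_ext)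
    ultimately show "z = z' \<and> (a, b, c) = (a', b', c')" by simp
  qed
  moreover have "f ` Sigma Z trip \<subseteq> zero_sums"
  proof
    fix y assume "y \<in> f ` Sigma Z trip"
    then obtain z a b c where y: "y = f (z, a, b, c)" and z: "z \<in> Z" and t: "(a, b, c) \<in> trip z" by auto
    have "y \<in> PiE {..<k} coset"
    proof (rule PiE_I)
      fix i assume "i \<in> {..<k}"
      then show "y i \<in> coset i" using z t unfolding y f_def Z_def trip_def by (auto simp: PiE_iff)
    next
      fix i assume "i \<notin> {..<k}"
      then show "y i = undefined" using z k3 unfolding y f_def Z_def by (auto simp: PiE_iff extensional_def)
    qed
    moreover have "sum y {..<k} = a + (b + (c + sum z {3..<k}))"
    proof -
      have "sum y {3..<k} = sum z {3..<k}" unfolding y f_def by (intro sum.cong) auto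
      then show ?thesis unfolding split by (simp add: y f_def)
    qed
    moreover have "a + (b + (c + sum z {3..<k})) = 0"
      using t unfolding trip_def by (simp add: add.assoc eq_neg_iff_add_eq_0)
    ultimately show "y \<in> zero_sums" unfolding zero_sums_def by simp
  qed
  ultimately have "card (Sigma Z trip) \<le> card zero_sums" using finite_zero_sums by (rule card_inj_on_le)
  moreover have "real (card (Sigma Z trip)) \<ge> real (card Z) * ((real (2 * w))\<^sup>2 / (2 * real k))"
  proof -
    have "real (card (trip z)) \<ge> (real (2 * w))\<^sup>2 / (2 * real k)" if "z \<in> Z" for z
    proof -
      have "- sum z {3..<k} \<in> K"
        using that coset_subset unfolding Z_def by (intro K_uminus K_sum) (meson DiffD1 PiE_mem subsetD)
      then show ?thesis unfolding trip_def by (rule three_cosets_ge[OF w])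
    qed
    then have "(\<Sum>z\<in>Z. (real (2 * w))\<^sup>2 / (2 * real k)) \<le> (\<Sum>z\<in>Z. real (card (trip z)))" by (rule sum_mono)
    then show ?thesis using finZ fint by (simp add: card_SigmaI)
  qed
  ultimately show ?thesis unfolding cardZ by (simp only: of_nat_power flip: of_nat_le_iff[where 'a = real])
qed

text \<open>Beyond k the sequence is \<open>undefined\<close>; truncation keeps the partial sums in
  K at every index.\<close>

definition partial_sums :: "(nat \<Rightarrow> 'a) \<Rightarrow> nat \<Rightarrow> 'a" where
  "partial_sums y i = sum y {..<min i k}"

lemma partial_sums_Suc: "i < k \<Longrightarrow> partial_sums y (Suc i) - partial_sums y i = y i"
  unfolding partial_sums_def by (simp add: min_def)

lemma partial_sums_in_K: "y \<in> zero_sums \<Longrightarrow> partial_sums y i \<in> K"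
  unfolding partial_sums_def using zero_sums_in_K by (intro K_sum) auto

lemma partial_sums_closed: "y \<in> zero_sums \<Longrightarrow> partial_sums y k = partial_sums y 0"
  unfolding partial_sums_def zero_sums_def by simp

lemma inj_partial_sums:
  assumes "y \<in> proper_zero_sums"
  shows "inj_on (partial_sums y) {..<k}"
proof (rule linorder_inj_onI)
  fix i j assume ij: "i < j" "i \<in> {..<k}" "j \<in> {..<k}"
  have "partial_sums y j = partial_sums y i + sum y {i..<j}"
    using ij sum.atLeastLessThan_concat[of 0 i j y] unfolding partial_sums_def
    by (simp add: min_def atLeast0LessThan)
  moreover have "sum y {i..<j} \<noteq> 0" using assms ij unfolding proper_zero_sums_def by auto
  ultimately show "partial_sums y i \<noteq> partial_sums y j" by simp
qed auto

lemma k_cycle_system_partial_sums: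
  assumes h: "bij_betw h K V" and y: "y \<in> proper_zero_sums"
  shows "k_cycle_system k V (affine_system h K k (partial_sums y) scalars)"
proof (rule k_cycle_system_affine[OF h k3])
  have y': "y \<in> zero_sums" using y unfolding proper_zero_sums_def by simp
  show "partial_sums y k = partial_sums y 0" by (rule partial_sums_closed[OF y'])
  show "partial_sums y i \<in> K" for i by (rule partial_sums_in_K[OF y'])
  show "inj_on (partial_sums y) {..<k}" by (rule inj_partial_sums[OF y])
  show "scalars \<subseteq> K - {0}" by (rule scalars_subset)
  show "k * card scalars = m" by (simp add: card_scalars m_eq)
  fix t t' i j
  assume *: "t \<in> scalars" "t' \<in> scalars" "i < k" "j < k"
    "t * (partial_sums y (Suc i) - partial_sums y i) = t' * (partial_sums y (Suc j) - partial_sums y j) \<or>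
     t * (partial_sums y (Suc i) - partial_sums y i) = - (t' * (partial_sums y (Suc j) - partial_sums y j))"
  have "y i \<in> coset i" "y j \<in> coset j" using y' * unfolding zero_sums_def by auto
  then show "t = t' \<and> i = j"
    using scalars_differences[of t t' "y i" i "y j" j] * by (simp add: partial_sums_Suc)
qed

lemma orthogonal_systems_partial_sums:
  assumes h: "inj_on h K" and y: "y \<in> zero_sums" and z: "z \<in> zero_sums" and c: "\<not> conflict y z"
  shows "orthogonal_systems (affine_system h K k (partial_sums y) scalars) (affine_system h K k (partial_sums z) scalars)"
proof (rule orthogonal_systems_affine[OF h])
  show "k > 0" using k3 by simp
  fix i j a b assume "i < k" "j < k" "a < k" "b < k" "i \<noteq> j" "a \<noteq> b"
  then show "(partial_sums y (Suc i) - partial_sums y i) * (partial_sums z (Suc b) - partial_sums z b)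
      \<noteq> (partial_sums y (Suc j) - partial_sums y j) * (partial_sums z (Suc a) - partial_sums z a) \<and>
      (partial_sums y (Suc i) - partial_sums y i) * (partial_sums z (Suc b) - partial_sums z b)
      \<noteq> - ((partial_sums y (Suc j) - partial_sums y j) * (partial_sums z (Suc a) - partial_sums z a))"
    using c unfolding conflict_def by (simp add: partial_sums_Suc) blast
qed (use y z partial_sums_in_K partial_sums_closed scalars_subset in auto)

text \<open>A cycle shares two edges with itself. This shows that conflict-free sequences give
  different systems, so counting sequences counts systems.\<close>

lemma not_orthogonal_self:
  assumes h: "bij_betw h K V" and S: "k_cycle_system k V S"
  shows "\<not> orthogonal_systems S S"
proof
  assume o: "orthogonal_systems S S"
  have "h 0 \<in> V" "h e \<in> V" "h 0 \<noteq> h e"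
    using h zero_in_K e_in_K e_nonzero unfolding bij_betw_def inj_on_def by blast+
  then have "{h 0, h e} \<in> complete_edges V" unfolding complete_edges_def by blast
  then obtain C where C: "C \<in> S" using S unfolding k_cycle_system_def by blast
  then have "is_k_cycle k C" using S unfolding k_cycle_system_def by blast
  then obtain xs where xs: "length xs = k" "distinct xs" "C = cycle_edges xs"
    unfolding is_k_cycle_def by blast
  have edge: "{xs ! i, xs ! ((i + 1) mod k)} \<in> C" if "i < k" for i
    unfolding xs(3) cycle_edges_def using xs(1) that by blast
  have "{xs ! 0, xs ! 1} \<in> C" "{xs ! 1, xs ! 2} \<in> C"
    using edge[of 0] edge[of 1] k3 by (simp_all add: numeral_2_eq_2)
  moreover have "{xs ! 0, xs ! 1} \<noteq> {xs ! 1, xs ! 2}"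
    using xs(1,2) k3 by (auto simp: doubleton_eq_iff nth_eq_iff_index_eq)
  moreover have "finite C" unfolding xs(3) cycle_edges_def by simp
  ultimately have "card {{xs ! 0, xs ! 1}, {xs ! 1, xs ! 2}} \<le> card C" by (intro card_mono) auto
  then have "card (C \<inter> C) \<ge> 2" using \<open>{xs ! 0, xs ! 1} \<noteq> {xs ! 1, xs ! 2}\<close> by simp
  moreover have "card (C \<inter> C) \<le> 1" using o C unfolding orthogonal_systems_def by blast
  ultimately show False by simp
qed

lemma ex_many_orthogonal_systems:
  assumes h: "bij_betw h K V" and w: "w > 4 * k ^ 4"
  shows "\<exists>\<S>. finite \<S> \<and> real w / (4 * real k ^ 4) \<le> real (card \<S>) \<and>
     (\<forall>S\<in>\<S>. k_cycle_system k V S) \<and> (\<forall>S\<in>\<S>. \<forall>S'\<in>\<S>. S \<noteq> S' \<longrightarrow> orthogonal_systems S S')"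
proof -
  obtain F where F: "F \<subseteq> proper_zero_sums" "\<And>y z. y \<in> F \<Longrightarrow> z \<in> F \<Longrightarrow> y \<noteq> z \<Longrightarrow> \<not> conflict y z"
    "card proper_zero_sums \<le> card F * (2 * k ^ 3 * (2 * w) ^ (k - 2))"
    using ex_conflict_free by blast
  have finF: "finite F"
    using F(1) by (rule finite_subset) (simp add: proper_zero_sums_def finite_zero_sums)
  have Fz: "y \<in> zero_sums" if "y \<in> F" for y using that F(1) unfolding proper_zero_sums_def by blast
  define sys where "sys y = affine_system h K k (partial_sums y) scalars" for y
  have sys: "k_cycle_system k V (sys y)" if "y \<in> F" for y
    unfolding sys_def using k_cycle_system_partial_sums[OF h] that F(1) by blast
  have orth: "orthogonal_systems (sys y) (sys z)" if "y \<in> F" "z \<in> F" "y \<noteq> z" for y z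
    unfolding sys_def using orthogonal_systems_partial_sums that F(2) Fz h unfolding bij_betw_def by blast
  have "inj_on sys F"
    using orth sys not_orthogonal_self[OF h] by (intro inj_onI) metis
  then have card: "card (sys ` F) = card F" by (rule card_image)

  define M where "M = real (2 * w)"
  define \<kappa> where "\<kappa> = real k"
  have M0: "M > 0" unfolding M_def using w_pos by simp
  have \<kappa>: "\<kappa> \<ge> 3" using k3 unfolding \<kappa>_def by simp
  have "card zero_sums \<le> card F * (2 * k ^ 3 * (2 * w) ^ (k - 2)) + k ^ 2 * (2 * w) ^ (k - 2)"
    using card_zero_sums_le F(3) by linarith
  then have "real (card zero_sums) \<le> real (card F * (2 * k ^ 3 * (2 * w) ^ (k - 2)) + k ^ 2 * (2 * w) ^ (k - 2))"
    by (simp only: of_nat_le_iff)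
  also have "\<dots> = (real (card F) * (2 * \<kappa> ^ 3) + \<kappa>\<^sup>2) * M ^ (k - 2)"
    unfolding M_def \<kappa>_def by (simp add: algebra_simps)
  finally have "M ^ (k - 3) * (M\<^sup>2 / (2 * \<kappa>)) \<le> (real (card F) * (2 * \<kappa> ^ 3) + \<kappa>\<^sup>2) * M ^ (k - 2)"
    using card_zero_sums_ge[OF w] unfolding M_def \<kappa>_def by linarith
  also have "M ^ (k - 3) * (M\<^sup>2 / (2 * \<kappa>)) = (M / (2 * \<kappa>)) * M ^ (k - 2)"
  proof -
    have "k - 2 = Suc (k - 3)" using k3 by simp
    then have "M ^ (k - 2) = M * M ^ (k - 3)" by simp
    then show ?thesis by (simp add: power2_eq_square)
  qed
  finally have "M / (2 * \<kappa>) \<le> real (card F) * (2 * \<kappa> ^ 3) + \<kappa>\<^sup>2"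
    by (rule mult_right_le_imp_le) (use M0 in simp)
  then have "M \<le> (real (card F) * (2 * \<kappa> ^ 3) + \<kappa>\<^sup>2) * (2 * \<kappa>)"
    using \<kappa> by (simp add: divide_le_eq)
  then have le: "M \<le> 4 * \<kappa> ^ 4 * real (card F) + 2 * \<kappa> ^ 3"
    by (simp add: power2_eq_square power3_eq_cube power4_eq_xxxx algebra_simps)
  have "real w > real (4 * k ^ 4)" using w by (simp only: of_nat_less_iff)
  then have wk: "real w > 4 * \<kappa> ^ 4" unfolding \<kappa>_def by simp
  have "\<kappa> ^ 4 \<ge> \<kappa> ^ 3" using \<kappa> by (intro power_increasing) auto
  \<comment> \<open>Of M = 2 w, one copy of w exceeds 4 k^4 and so pays for the term 2 k^3 left by
    the improper sequences.\<close>
  then have "real w \<le> 4 * \<kappa> ^ 4 * real (card F)" using le wk unfolding M_def by simp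
  then have "real w / (4 * real k ^ 4) \<le> real (card (sys ` F))"
    unfolding card \<kappa>_def[symmetric] using \<kappa> by (simp add: divide_le_eq mult.commute)
  then show ?thesis using finF sys orth by (intro exI[of _ "sys ` F"]) auto
qed

text \<open>The vertices are powers of g^(2 w), of order k, so each difference is a constant c times
  a vertex and c cancels. Equality up to sign gives a + 2 w i = b + 2 w j modulo k w: modulo w this
  yields a = b, and then oddness of k yields i = j.\<close>

lemma ex_k_cycle_system:
  assumes h: "bij_betw h K V" and odd: "odd k"
  shows "\<exists>S. k_cycle_system k V S"
proof -
  define v where "v i = e * g ^ (2 * w * i)" for i
  define T where "T = (\<lambda>a. e * g ^ a) ` {..<w}"
  define c where "c = e * g ^ (2 * w) - e"
  have dist: "a = b" if "a < k" "b < k" "[2 * w * a = 2 * w * b] (mod n)" for a b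
  proof -
    have "2 * w * a < n" "2 * w * b < n" using that w_pos by (simp_all add: n_kw)
    then have "2 * w * a = 2 * w * b" using that(3) by (simp add: cong_def)
    then show ?thesis using w_pos by simp
  qed
  have c: "c \<in> K" "c \<noteq> 0"
  proof -
    show "c \<in> K" unfolding c_def using K_diff pow_in_K e_in_K by blast
    have "\<not> [2 * w * 1 = 2 * w * 0] (mod n)" using dist[of 1 0] k3 by auto
    then have "e * g ^ (2 * w) \<noteq> e * g ^ 0" unfolding pow_eq_iff by (simp add: cong_def)
    then show "c \<noteq> 0" unfolding c_def by simp
  qed
  have diff: "v (Suc i) - v i = c * v i" for i
  proof -
    have "v (Suc i) = (e * e) * g ^ (2 * w) * g ^ (2 * w * i)"
      unfolding v_def e_idem by (simp add: power_add algebra_simps)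
    moreover have "v i = (e * e) * g ^ (2 * w * i)" unfolding v_def e_idem ..
    moreover have "c * v i = (e * e) * g ^ (2 * w) * g ^ (2 * w * i) - (e * e) * g ^ (2 * w * i)"
      unfolding c_def v_def by (simp add: algebra_simps)
    ultimately show ?thesis by simp
  qed
  have "k_cycle_system k V (affine_system h K k v T)"
  proof (rule k_cycle_system_affine[OF h k3])
    show "v k = v 0" unfolding v_def pow_eq_iff by (simp add: n_kw)
    show "v i \<in> K" for i unfolding v_def by (rule pow_in_K)
    show "inj_on v {..<k}"
      unfolding v_def by (rule inj_onI) (use dist pow_eq_iff in \<open>auto simp: cong_def\<close>)
    show "T \<subseteq> K - {0}" unfolding T_def using pow_in_K pow_nonzero by auto
    have "inj_on (\<lambda>a. e * g ^ a) {..<w}"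
    proof (rule inj_onI)
      fix a b assume "a \<in> {..<w}" "b \<in> {..<w}" "e * g ^ a = e * g ^ b"
      moreover have "w \<le> n" using k3 by (simp add: n_kw)
      ultimately show "a = b" unfolding pow_eq_iff by simp
    qed
    then show "k * card T = m" unfolding T_def by (simp add: card_image m_eq)
    fix t t' i j
    assume T: "t \<in> T" "t' \<in> T" and ij: "i < k" "j < k"
      and eq: "t * (v (Suc i) - v i) = t' * (v (Suc j) - v j) \<or> t * (v (Suc i) - v i) = - (t' * (v (Suc j) - v j))"
    obtain a b where ab: "a < w" "b < w" "t = e * g ^ a" "t' = e * g ^ b" using T unfolding T_def by auto
    have "c * (t * v i) = c * (t' * v j) \<or> c * (t * v i) = c * (- (t' * v j))"
      using eq unfolding diff by (simp add: algebra_simps)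
    moreover have K: "t * v i \<in> K" "t' * v j \<in> K" unfolding ab v_def pow_mult by (rule pow_in_K)+
    ultimately have "t * v i = t' * v j \<or> t * v i = - (t' * v j)" using K_cancel[OF c] K_uminus by blast
    then have cg: "[a + w * (2 * i) = b + w * (2 * j)] (mod w * k)"
      unfolding ab v_def pow_mult pow_eq_pm_iff by (simp add: cong_def m_eq ac_simps)
    then have "[a + w * (2 * i) = b + w * (2 * j)] (mod w)" by (rule cong_dvd_modulus_nat) simp
    then have "a = b" using ab by (simp add: cong_def)
    then have "[w * (2 * i) = w * (2 * j)] (mod w * k)" using cg by (simp only: cong_add_lcancel_nat)
    then have "[2 * i = 2 * j] (mod k)" using w_pos by (simp add: cong_def flip: mult_mod_right)
    moreover have "coprime 2 k" using odd by simp
    ultimately have "[i = j] (mod k)" by (simp add: cong_mult_lcancel_nat)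
    then have "i = j" using ij by (simp add: cong_def)
    then show "t = t' \<and> i = j" using ab \<open>a = b\<close> by simp
  qed
  then show ?thesis by blast
qed

end

theorem theorem1p16:
  fixes k w :: nat
  assumes "k \<ge> 3" and "w > 0" and "odd (k * w)"
    and "primepow (2 * k * w + 1)"
  shows "\<exists>F :: nat set set set set.
           finite F \<and>
           card F \<ge> nat \<lceil>real w / (4 * real k ^ 4)\<rceil> \<and>
           (\<forall>S\<in>F. k_cycle_system k {..<2 * k * w + 1} S) \<and>
           (\<forall>S\<in>F. \<forall>S'\<in>F. S \<noteq> S' \<longrightarrow> orthogonal_systems S S')"
proof -
  obtain K :: "gf_prod set" and e g where "embedded_gf K e g (2 * k * w)"
    using ex_embedded_gf[OF assms(4)] by auto
  then interpret embedded_gf K e g "2 * k * w" .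
  interpret coset_setup K e g "2 * k * w" "k * w" k w
    by unfold_locales (use assms(1) in simp_all)
  \<comment> \<open>Field elements are relabelled as natural numbers to obtain the prescribed vertex
    set.\<close>
  have "card K = card {..<2 * k * w + 1}" using card_K by simp
  then obtain h where h: "bij_betw h K {..<2 * k * w + 1}"
    using finite_same_card_bij[OF finite_K] by blast
  show ?thesis
  proof (cases "w > 4 * k ^ 4")
    case True
    from ex_many_orthogonal_systems[OF h True] obtain F where F: "finite F"
      "real w / (4 * real k ^ 4) \<le> real (card F)" "\<forall>S\<in>F. k_cycle_system k {..<2 * k * w + 1} S"
      "\<forall>S\<in>F. \<forall>S'\<in>F. S \<noteq> S' \<longrightarrow> orthogonal_systems S S'" by blast
    have "nat \<lceil>real w / (4 * real k ^ 4)\<rceil> \<le> card F" using F(2) by linarith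
    then show ?thesis using F by blast
  next
    case False
    have "odd k" using assms(3) by simp
    then obtain S where S: "k_cycle_system k {..<2 * k * w + 1} S" using ex_k_cycle_system[OF h] by blast
    have "real w \<le> real (4 * k ^ 4)" using False by (simp only: of_nat_le_iff not_less)
    then have "real w / (4 * real k ^ 4) \<le> 1" using assms(1) by (simp add: divide_le_eq)
    then have "nat \<lceil>real w / (4 * real k ^ 4)\<rceil> \<le> card {S}" by simp
    then show ?thesis using S by (intro exI[of _ "{S}"]) auto
  qed
qed

end
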